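(* For $j=1,2$ let $G_j$ be an $r_j$-regular connected graph with $p_j$ vertices and $q_j$ edges, with $r_1\ge 2$. Let $r_1,\lambda_2,\ldots,\lambda_{p_1}$ and $r_2,\gamma_2,\ldots,\gamma_{p_2}$ be the adjacency eigenvalues (with multiplicity) of $G_1$ and $G_2$ respectively. Then the eigenvalues (with multiplicity) of $\epsilon(G_1\veebar G_2)$ consist of: 1. $0$, with multiplicity $q_1-p_1$; 2. $-2(1+\gamma_k)$, for $k=2,3,\ldots,p_2$; 3. $-2(1+\lambda_i)\pm\sqrt{4(1+\lambda_i)^2+9(\lambda_i+r_1)}$, for $i=2,\ldots,p_1$; 4. the three eigenvalues of the matrix $$\begin{pmatrix}4(p_1-1-r_1)&3(q_1-r_1)&2p_2\\3(p_1-2)&0&0\\2p_1&0&2(p_2-r_2-1)\end{pmatrix}$$ (the equitable quotient matrix of $\epsilon(G_1\veebar G_2)$).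
   Context: All graphs are finite, simple and undirected. The subdivision graph $S(G)$ of a graph $G$ is obtained from $G$ by subdividing each edge with one new vertex; $I(G)$ is the set of these new vertices, so $V(S(G))=V(G)\cup I(G)$. For vertex-disjoint graphs $G_1,G_2$, the subdivision-edge join $G_1\veebar G_2$ is obtained from $S(G_1)$ and $G_2$ by joining each vertex of $I(G_1)$ to every vertex of $V(G_2)$. For a connected graph $G$ with distance function $d$, the eccentricity of a vertex $v$ is $e(v)=\max\{d(v,u):u\in V(G)\}$. The eccentricity matrix $\epsilon(G)$ is the symmetric matrix indexed by $V(G)$ with $(u,v)$ entry $d(u,v)$ if $d(u,v)=\min\{e(u),e(v)\}$, and $0$ otherwise. The quotient matrix in item 4 is taken with respect to the partition $V(G_1)\cup I(G_1)\cup V(G_2)$. *)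

theory Defs
  imports
    "Graph_Theory.Graph_Theory"
    "Jordan_Normal_Form.Char_Poly"
    "HOL-Computational_Algebra.Fundamental_Theorem_Algebra"
    "HOL-Library.Disjoint_Sets"
begin

text \<open>
  A finite simple undirected graph is a \<^locale>\<open>pair_graph\<close>: a finite, loop-free digraph whose arc
  relation is symmetric. An undirected edge is the pair of opposite arcs \<open>(u, v)\<close> and \<open>(v, u)\<close>,
  identified below with the two-element set \<open>{u, v}\<close>.
\<close>

definition edges :: "'a pair_pre_digraph \<Rightarrow> 'a set set" where
  "edges G = {{u, v} | u v. (u, v) \<in> parcs G}"

definition regular :: "'a pair_pre_digraph \<Rightarrow> nat \<Rightarrow> bool" where
  "regular G r \<longleftrightarrow> (\<forall>v \<in> pverts G. out_degree (with_proj G) v = r)"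

text \<open>In \<open>S(G)\<close>, \<open>Inl v\<close> is the original vertex \<open>v\<close> and \<open>Inr e\<close> is the vertex subdividing \<open>e\<close>.\<close>

definition subdivision_graph :: "'a pair_pre_digraph \<Rightarrow> ('a + 'a set) pair_pre_digraph" where
  "subdivision_graph G =
    \<lparr> pverts = pverts G <+> edges G,
      parcs = {(Inl v, Inr e) | v e. e \<in> edges G \<and> v \<in> e}
            \<union> {(Inr e, Inl v) | v e. e \<in> edges G \<and> v \<in> e} \<rparr>"

text \<open>The disjoint sum makes \<open>G1\<close> and \<open>G2\<close> vertex-disjoint.\<close>

definition subdivision_edge_join ::
    "'a pair_pre_digraph \<Rightarrow> 'b pair_pre_digraph \<Rightarrow> (('a + 'a set) + 'b) pair_pre_digraph" where
  "subdivision_edge_join G1 G2 =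
    \<lparr> pverts = pverts (subdivision_graph G1) <+> pverts G2,
      parcs = map_prod Inl Inl ` parcs (subdivision_graph G1)
            \<union> map_prod Inr Inr ` parcs G2
            \<union> {(Inl (Inr e), Inr w) | e w. e \<in> edges G1 \<and> w \<in> pverts G2}
            \<union> {(Inr w, Inl (Inr e)) | e w. e \<in> edges G1 \<and> w \<in> pverts G2} \<rparr>"

text \<open>The blocks \<open>V(G1)\<close>, \<open>I(G1)\<close>, \<open>V(G2)\<close> of the vertex set of the join, in this order.\<close>

definition join_blocks ::
    "'a pair_pre_digraph \<Rightarrow> 'b pair_pre_digraph \<Rightarrow> (('a + 'a set) + 'b) set list" where
  "join_blocks G1 G2 =
    [(Inl \<circ> Inl) ` pverts G1, (Inl \<circ> Inr) ` edges G1, Inr ` pverts G2]"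

text \<open>
  Graph distance is the library's shortest-path cost with unit weights. It is finite in connected
  graphs; otherwise \<^const>\<open>real_of_ereal\<close> would send the distance \<open>\<infinity>\<close> to \<open>0\<close>, so the notions
  below are meant for connected graphs only.
\<close>

definition gdist :: "'a pair_pre_digraph \<Rightarrow> 'a \<Rightarrow> 'a \<Rightarrow> real" where
  "gdist G u v = real_of_ereal (wf_digraph.\<mu> (with_proj G) (\<lambda>_. 1) u v)"

definition eccentricity :: "'a pair_pre_digraph \<Rightarrow> 'a \<Rightarrow> real" where
  "eccentricity G v = Max (gdist G v ` pverts G)"

definition adjacency_entry :: "'a pair_pre_digraph \<Rightarrow> 'a \<Rightarrow> 'a \<Rightarrow> real" where
  "adjacency_entry G u v = (if (u, v) \<in> parcs G then 1 else 0)"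

definition eccentricity_entry :: "'a pair_pre_digraph \<Rightarrow> 'a \<Rightarrow> 'a \<Rightarrow> real" where
  "eccentricity_entry G u v =
    (if gdist G u v = min (eccentricity G u) (eccentricity G v) then gdist G u v else 0)"

text \<open>
  A matrix indexed by a finite set is given by its entry function; an enumeration \<open>vs\<close> of the index
  set (\<open>distinct vs\<close>) turns it into a matrix indexed by \<open>0, \<dots>, length vs - 1\<close>. Another enumeration
  conjugates the matrix by a permutation matrix and hence leaves the eigenvalues unchanged.
\<close>

definition matrix_on :: "'a list \<Rightarrow> ('a \<Rightarrow> 'a \<Rightarrow> real) \<Rightarrow> real mat" where
  "matrix_on vs M = mat (length vs) (length vs) (\<lambda>(i, j). M (vs ! i) (vs ! j))"

definition adjacency_matrix :: "'a list \<Rightarrow> 'a pair_pre_digraph \<Rightarrow> real mat" where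
  "adjacency_matrix vs G = matrix_on vs (adjacency_entry G)"

definition eccentricity_matrix :: "'a list \<Rightarrow> 'a pair_pre_digraph \<Rightarrow> real mat" where
  "eccentricity_matrix vs G = matrix_on vs (eccentricity_entry G)"

text \<open>
  Eigenvalues are taken over the complex numbers, so that an \<open>n \<times> n\<close> matrix has exactly \<open>n\<close> of them
  counted with algebraic multiplicity, also when it is not symmetric.
\<close>

definition eigenvalues :: "real mat \<Rightarrow> complex multiset" where
  "eigenvalues A = proots (char_poly (map_mat complex_of_real A))"

definition equitable_partition :: "('a \<Rightarrow> 'a \<Rightarrow> real) \<Rightarrow> 'a set \<Rightarrow> 'a set list \<Rightarrow> bool" where
  "equitable_partition M V Xs \<longleftrightarrow>
    distinct Xs \<and> partition_on V (set Xs) \<and>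
    (\<forall>X \<in> set Xs. \<forall>Y \<in> set Xs. \<forall>u \<in> X. \<forall>u' \<in> X. (\<Sum>v\<in>Y. M u v) = (\<Sum>v\<in>Y. M u' v))"

text \<open>The \<open>(i, j)\<close> entry is the average row sum of the block with rows \<open>Xs ! i\<close> and columns \<open>Xs ! j\<close>.\<close>

definition quotient_matrix :: "('a \<Rightarrow> 'a \<Rightarrow> real) \<Rightarrow> 'a set list \<Rightarrow> real mat" where
  "quotient_matrix M Xs = mat (length Xs) (length Xs)
    (\<lambda>(i, j). (\<Sum>u \<in> Xs ! i. \<Sum>v \<in> Xs ! j. M u v) / real (card (Xs ! i)))"

end

(*
  The join has diameter at most 4, and all distances are explicit. Hence the eccentricity matrix is
  block-constant up to the matrix ((-4(I + A1), -3R, 0), (-3R^T, 0, 0), (0, 0, -2(I + A2))), where R is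
  the incidence matrix of G1. By regularity, the indicator vectors of the three blocks span an
  invariant subspace of this remainder, so adding the block-constant part changes only the three
  eigenvalues on that subspace, into those of the quotient matrix. The spectrum of the remainder
  follows from R R^T = A1 + r1 I and a Schur complement: each eigenvalue l of A1 contributes the two
  roots of x^2 + 4(1 + l)x - 9(l + r1).
*)
theory Submission
  imports Defs
begin

section \<open>Characteristic polynomials\<close>

text \<open>Multiplicities are tracked through characteristic polynomials, so no eigenvectors have
  to be produced or counted. For \<open>D U = U E\<close> the key identity is \<open>char_poly (D +
  U V) char_poly E = char_poly D char_poly (E + V U)\<close>. Here \<open>char_poly E\<close>
  consists exactly of the factors that the trivial eigenvalues \<open>r1\<close> and
  \<open>r2\<close> contribute to \<open>char_poly D\<close>; cancelling it leaves the indices from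
  2 on, next to the quotient matrix \<open>E + V U\<close>.

  An obstacle is that a vertex of \<open>G1\<close> has eccentricity 3 or 4 in the join, according
  to whether it is adjacent to all others. The entries do not depend on this: adjacent vertices have
  distance 2, below either value, and a nonadjacent pair has distance 4 and so forces both
  eccentricities to be 4. The degree bound \<open>r1 \<ge> 2\<close> gives the lower bound 3.

  The square roots are harmless because every eigenvalue of \<open>A1\<close> is at least
  \<open>- r1\<close>.\<close>

lemma char_poly_matrix_four_block:
  fixes A :: "'a :: comm_ring_1 mat"
  assumes "A \<in> carrier_mat n n" "B \<in> carrier_mat n m" "C \<in> carrier_mat m n" "D \<in> carrier_mat m m"
  shows "char_poly_matrix (four_block_mat A B C D) =
    four_block_mat (char_poly_matrix A) (map_mat (\<lambda>a. [:- a:]) B) (map_mat (\<lambda>a. [:- a:]) C) (char_poly_matrix D)"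
  using assms unfolding char_poly_matrix_def by (intro eq_matI) (auto simp: one_poly_def)

lemma char_poly_four_block_upper_right_zero:
  fixes A :: "'a :: idom mat"
  assumes A: "A \<in> carrier_mat n n" and C: "C \<in> carrier_mat m n" and D: "D \<in> carrier_mat m m"
  shows "char_poly (four_block_mat A (0\<^sub>m n m) C D) = char_poly A * char_poly D"
proof -
  have "map_mat (\<lambda>a. [:- a:]) (0\<^sub>m n m) = (0\<^sub>m n m :: 'a poly mat)"
    by (intro eq_matI) auto
  then show ?thesis
    unfolding char_poly_def char_poly_matrix_four_block[OF A zero_carrier_mat C D]
    using A C D by (intro det_four_block_mat_upper_right_zero[of _ n _ m]) auto
qed

text \<open>Conjugation by \<open>((I, U), (0, I))\<close> turns \<open>((D + U V, 0), (V, E))\<close> into \<open>((D, 0), (V, E + V U))\<close>.\<close>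

lemma char_poly_add_mult:
  fixes D :: "'a :: idom mat"
  assumes D: "D \<in> carrier_mat n n" and E: "E \<in> carrier_mat k k"
    and U: "U \<in> carrier_mat n k" and V: "V \<in> carrier_mat k n" and DU: "D * U = U * E"
  shows "char_poly (D + U * V) * char_poly E = char_poly D * char_poly (E + V * U)"
proof -
  define S where "S = four_block_mat (D + U * V) (0\<^sub>m n k) V E"
  define T where "T = four_block_mat D (0\<^sub>m n k) V (E + V * U)"
  define P where "P = four_block_mat (1\<^sub>m n) U (0\<^sub>m k n) (1\<^sub>m k)"
  define P' where "P' = four_block_mat (1\<^sub>m n) (- U) (0\<^sub>m k n) (1\<^sub>m k)"
  have c: "S \<in> carrier_mat (n + k) (n + k)" "T \<in> carrier_mat (n + k) (n + k)"
    "P \<in> carrier_mat (n + k) (n + k)" "P' \<in> carrier_mat (n + k) (n + k)"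
    using D E U V by (auto simp: S_def T_def P_def P'_def)
  have UV: "U * V \<in> carrier_mat n n" and VU: "V * U \<in> carrier_mat k k"
    and UE: "U * E \<in> carrier_mat n k" using U V E by auto
  have inv: "U + - U = 0\<^sub>m n k" "- U + U = 0\<^sub>m n k" "- 0\<^sub>m k k = (0\<^sub>m k k :: 'a mat)"
    using U by (auto intro!: eq_matI)
  have PP': "P * P' = 1\<^sub>m (n + k)" "P' * P = 1\<^sub>m (n + k)"
    unfolding P_def P'_def using U inv
    by (subst mult_four_block_mat[of _ n n _ k _ k _ _ n _ k]; simp)+
  have SP: "S * P = four_block_mat (D + U * V) ((D + U * V) * U) V (V * U + E)"
    unfolding S_def P_def using D E U V UV UE VU
    by (subst mult_four_block_mat[of _ n n _ k _ k _ _ n _ k]) auto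
  have "P * T = four_block_mat (D + U * V) (U * (E + V * U)) V (E + V * U)"
    unfolding T_def P_def using D E U V UV UE VU
    by (subst mult_four_block_mat[of _ n n _ k _ k _ _ n _ k]) auto
  \<comment> \<open>Here \<open>DU\<close> enters: both sides equal
    \<open>U E + U V U\<close>.\<close>
  moreover have "(D + U * V) * U = U * (E + V * U)"
    using D E U V UV UE VU DU
    by (simp add: add_mult_distrib_mat[of _ n n] mult_add_distrib_mat[of _ n k] assoc_mult_mat[of _ n k _ n _ k])
  moreover have "V * U + E = E + V * U"
    using E VU by (simp add: comm_add_mat[of _ k k])
  ultimately have "S * P = P * T" using SP by simp
  then have "S = P * T * P'"
    using PP' c by (metis assoc_mult_mat right_mult_one_mat)
  then have "similar_mat S T"
    unfolding similar_mat_def using PP' c by (blast intro: similar_mat_witI)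
  then have "char_poly S = char_poly T" by (rule char_poly_similar)
  then show ?thesis
    unfolding S_def T_def using D E U V UV VU
    by (simp add: char_poly_four_block_upper_right_zero)
qed

lemma poly_char_poly:
  fixes A :: "'a :: field mat"
  assumes "A \<in> carrier_mat n n"
  shows "poly (char_poly A) x = det (x \<cdot>\<^sub>m 1\<^sub>m n - A)"
proof -
  have "- (char_matrix A x) = x \<cdot>\<^sub>m 1\<^sub>m n - A"
    using assms by (intro eq_matI) (auto simp: char_matrix_def)
  then show ?thesis using char_poly_matrix[OF assms, of x] by simp
qed

text \<open>A Schur complement with respect to the block \<open>x I\<close>; the factor \<open>x ^ n\<close> avoids dividing by \<open>x\<close>.\<close>

lemma poly_char_poly_four_block_lower_right_zero:
  fixes A :: "'a :: field mat"
  assumes A: "A \<in> carrier_mat n n" and B: "B \<in> carrier_mat n m" and C: "C \<in> carrier_mat m n"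
  shows "x ^ n * poly (char_poly (four_block_mat A B C (0\<^sub>m m m))) x =
    x ^ m * det (x\<^sup>2 \<cdot>\<^sub>m 1\<^sub>m n - x \<cdot>\<^sub>m A - B * C)"
proof -
  define N where "N = x \<cdot>\<^sub>m 1\<^sub>m (n + m) - four_block_mat A B C (0\<^sub>m m m)"
  \<comment> \<open>\<open>T\<close> is chosen to clear the lower left block of
    \<open>N * T\<close>, which becomes \<open>- x C + x C\<close>; its own determinant is
    \<open>x ^ n\<close>.\<close>
  define T where "T = four_block_mat (x \<cdot>\<^sub>m 1\<^sub>m n) (0\<^sub>m n m) C (1\<^sub>m m)"
  have N: "N = four_block_mat (x \<cdot>\<^sub>m 1\<^sub>m n - A) (- B) (- C) (x \<cdot>\<^sub>m 1\<^sub>m m)"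
    unfolding N_def using A B C by (intro eq_matI) auto
  have c: "N \<in> carrier_mat (n + m) (n + m)" "T \<in> carrier_mat (n + m) (n + m)"
    unfolding N T_def using A B C by auto
  have BC: "B * C \<in> carrier_mat n n" using B C by auto
  have e: "- C * (x \<cdot>\<^sub>m 1\<^sub>m n) + x \<cdot>\<^sub>m 1\<^sub>m m * C = 0\<^sub>m m n"
    using C by (intro eq_matI) (auto simp: mult_smult_distrib mult_smult_assoc_mat[of _ m m])
  have f: "(x \<cdot>\<^sub>m 1\<^sub>m n - A) * (x \<cdot>\<^sub>m 1\<^sub>m n) + - B * C = x\<^sup>2 \<cdot>\<^sub>m 1\<^sub>m n - x \<cdot>\<^sub>m A - B * C"
  proof -
    have "(x \<cdot>\<^sub>m 1\<^sub>m n - A) * (x \<cdot>\<^sub>m 1\<^sub>m n) = x \<cdot>\<^sub>m (x \<cdot>\<^sub>m 1\<^sub>m n - A)"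
      using mult_smult_distrib[OF minus_carrier_mat[OF A, of "x \<cdot>\<^sub>m 1\<^sub>m n"], of "1\<^sub>m n" n x]
        right_mult_one_mat[OF minus_carrier_mat[OF A, of "x \<cdot>\<^sub>m 1\<^sub>m n"]] by simp
    moreover have "- B * C = - (B * C)" using B C by simp
    ultimately show ?thesis using A B C
      by (intro eq_matI) (auto simp: algebra_simps power2_eq_square)
  qed
  have g: "(x \<cdot>\<^sub>m 1\<^sub>m n - A) * 0\<^sub>m n m + - B * 1\<^sub>m m = - B"
    "- C * 0\<^sub>m n m + x \<cdot>\<^sub>m 1\<^sub>m m * 1\<^sub>m m = x \<cdot>\<^sub>m 1\<^sub>m m"
    using A B C by auto
  have "N * T = four_block_mat ((x \<cdot>\<^sub>m 1\<^sub>m n - A) * (x \<cdot>\<^sub>m 1\<^sub>m n) + - B * C)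
      ((x \<cdot>\<^sub>m 1\<^sub>m n - A) * 0\<^sub>m n m + - B * 1\<^sub>m m)
      (- C * (x \<cdot>\<^sub>m 1\<^sub>m n) + x \<cdot>\<^sub>m 1\<^sub>m m * C)
      (- C * 0\<^sub>m n m + x \<cdot>\<^sub>m 1\<^sub>m m * 1\<^sub>m m)"
    unfolding N T_def using A B C
    by (intro mult_four_block_mat[of _ n n _ m _ m _ _ n _ m]) auto
  moreover have "x\<^sup>2 \<cdot>\<^sub>m 1\<^sub>m n - x \<cdot>\<^sub>m A - B * C \<in> carrier_mat n n"
    by (rule minus_carrier_mat[OF BC])
  ultimately have "det (N * T) = det (x\<^sup>2 \<cdot>\<^sub>m 1\<^sub>m n - x \<cdot>\<^sub>m A - B * C) * det (x \<cdot>\<^sub>m 1\<^sub>m m)"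
    unfolding e f g using B det_four_block_mat_lower_left_zero[OF _ _ refl]
    by (metis one_carrier_mat smult_carrier_mat uminus_carrier_mat)
  moreover have "det T = det (x \<cdot>\<^sub>m 1\<^sub>m n) * det (1\<^sub>m m :: 'a mat)"
    unfolding T_def by (rule det_four_block_mat_upper_right_zero[OF _ refl C]) auto
  moreover have "det N = poly (char_poly (four_block_mat A B C (0\<^sub>m m m))) x"
    unfolding N_def by (rule poly_char_poly[symmetric]) (use A in simp)
  ultimately show ?thesis using det_mult[OF c] by (simp add: mult.commute)
qed

lemma prod_mset_linear_neq_0: "(\<Prod>l\<in>#S. [:- f l, 1:]) \<noteq> (0 :: 'a :: idom poly)"
  by (induction S) (simp_all del: mult_pCons_left)

text \<open>For \<open>b \<noteq> 0\<close> the matrix is \<open>- b\<close> times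
  \<open>(- a / b) I - A\<close>, so its determinant is a scaled value of the characteristic
  polynomial. The case \<open>b = 0\<close> does occur later, where
  \<open>b = 4 x - 9\<close>.\<close>

lemma det_linear_combination:
  fixes A :: "'a :: field mat"
  assumes A: "A \<in> carrier_mat n n" and cp: "char_poly A = (\<Prod>l\<in>#S. [:- l, 1:])"
  shows "det (a \<cdot>\<^sub>m 1\<^sub>m n + b \<cdot>\<^sub>m A) = (\<Prod>l\<in>#S. a + b * l)"
proof -
  \<comment> \<open>Lets the scalar \<open>(- b) ^ n\<close> be distributed over the members of
    \<open>S\<close>, one factor each.\<close>
  have n: "size S = n"
  proof -
    have "degree (\<Prod>l\<in>#S. [:- l, 1:]) = size S"
      by (induction S)
        (simp_all add: degree_mult_eq prod_mset_linear_neq_0[of "\<lambda>l. l"] del: mult_pCons_left prod_mset_zero_iff)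
    then show ?thesis using degree_monic_char_poly[OF A] cp by simp
  qed
  show ?thesis
  proof (cases "b = 0")
    case True
    have "a \<cdot>\<^sub>m 1\<^sub>m n + 0 \<cdot>\<^sub>m A = a \<cdot>\<^sub>m 1\<^sub>m n" using A by (intro eq_matI) auto
    then show ?thesis using True n by simp
  next
    case False
    have "a \<cdot>\<^sub>m 1\<^sub>m n + b \<cdot>\<^sub>m A = (- b) \<cdot>\<^sub>m ((- a / b) \<cdot>\<^sub>m 1\<^sub>m n - A)"
      using A False by (intro eq_matI) (auto simp: algebra_simps)
    then have "det (a \<cdot>\<^sub>m 1\<^sub>m n + b \<cdot>\<^sub>m A) = (- b) ^ n * poly (char_poly A) (- a / b)"
      using A by (simp add: poly_char_poly[OF A])
    also have "poly (char_poly A) (- a / b) = (\<Prod>l\<in>#S. - a / b - l)"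
      unfolding cp by (induction S) (simp_all add: algebra_simps)
    also have "(- b) ^ n * \<dots> = (- b) ^ size S * \<dots>"
      by (simp add: n)
    also have "\<dots> = (\<Prod>l\<in>#S. (- b) * (- a / b - l))"
      by (induction S) (auto simp: mult_ac)
    also have "\<dots> = (\<Prod>l\<in>#S. a + b * l)"
      using False by (intro arg_cong[where f = prod_mset] image_mset_cong) (auto simp: field_simps)
    finally show ?thesis .
  qed
qed

section \<open>Matrices given by entry functions on lists\<close>

lemma matrix_on_carrier [simp]: "matrix_on vs M \<in> carrier_mat (length vs) (length vs)"
  by (simp add: matrix_on_def)

text \<open>Rectangular companion of \<open>matrix_on\<close>, for incidence blocks and block
  indicators. Matrix identities can then be checked on index elements instead of positions, with
  products as sums over sets.\<close>

definition rect_mat :: "'a list \<Rightarrow> 'b list \<Rightarrow> ('a \<Rightarrow> 'b \<Rightarrow> real) \<Rightarrow> real mat" where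
  "rect_mat us vs M = mat (length us) (length vs) (\<lambda>(i, j). M (us ! i) (vs ! j))"

lemma rect_mat_carrier [simp]: "rect_mat us vs M \<in> carrier_mat (length us) (length vs)"
  and rect_mat_dim [simp]: "dim_row (rect_mat us vs M) = length us" "dim_col (rect_mat us vs M) = length vs"
  by (simp_all add: rect_mat_def)

lemma matrix_on_eq_rect_mat: "matrix_on vs M = rect_mat vs vs M"
  by (simp add: matrix_on_def rect_mat_def)

lemma rect_mat_cong:
  "(\<And>u v. u \<in> set us \<Longrightarrow> v \<in> set vs \<Longrightarrow> M u v = N u v) \<Longrightarrow> rect_mat us vs M = rect_mat us vs N"
  by (auto simp: rect_mat_def intro!: eq_matI)

lemma rect_mat_add: "rect_mat us vs M + rect_mat us vs N = rect_mat us vs (\<lambda>u v. M u v + N u v)"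
  by (intro eq_matI) (auto simp: rect_mat_def)

lemma rect_mat_map: "rect_mat (map f us) (map g vs) M = rect_mat us vs (\<lambda>u v. M (f u) (g v))"
  by (intro eq_matI) (auto simp: rect_mat_def)

lemma rect_mat_smult: "c \<cdot>\<^sub>m rect_mat us vs M = rect_mat us vs (\<lambda>u v. c * M u v)"
  by (intro eq_matI) (auto simp: rect_mat_def)

lemma rect_mat_diff: "rect_mat us vs M - rect_mat us vs N = rect_mat us vs (\<lambda>u v. M u v - N u v)"
  by (intro eq_matI) (auto simp: rect_mat_def)

lemma rect_mat_zero: "(\<And>u v. u \<in> set us \<Longrightarrow> v \<in> set vs \<Longrightarrow> M u v = 0) \<Longrightarrow> rect_mat us vs M = 0\<^sub>m (length us) (length vs)"
  by (intro eq_matI) (auto simp: rect_mat_def)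

lemma rect_mat_mult:
  assumes "distinct vs"
  shows "rect_mat us vs M * rect_mat vs ws N = rect_mat us ws (\<lambda>u w. \<Sum>v\<in>set vs. M u v * N v w)"
proof (rule eq_matI)
  fix i j assume "i < dim_row (rect_mat us ws (\<lambda>u w. \<Sum>v\<in>set vs. M u v * N v w))"
    "j < dim_col (rect_mat us ws (\<lambda>u w. \<Sum>v\<in>set vs. M u v * N v w))"
  moreover have "(\<Sum>v\<in>set vs. f v) = (\<Sum>k = 0..<length vs. f (vs ! k))" for f :: "_ \<Rightarrow> real"
    using sum.reindex_bij_betw[OF bij_betw_nth[OF assms refl refl], of f] by (simp add: atLeast0LessThan)
  ultimately show "(rect_mat us vs M * rect_mat vs ws N) $$ (i, j) =
      rect_mat us ws (\<lambda>u w. \<Sum>v\<in>set vs. M u v * N v w) $$ (i, j)"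
    by (simp add: rect_mat_def scalar_prod_def)
qed auto

lemma rect_mat_one: "distinct vs \<Longrightarrow> 1\<^sub>m (length vs) = rect_mat vs vs (\<lambda>u v. of_bool (u = v))"
  by (intro eq_matI) (auto simp: rect_mat_def nth_eq_iff_index_eq)

lemma rect_mat_append:
  "rect_mat (us @ us') (vs @ vs') M =
    four_block_mat (rect_mat us vs M) (rect_mat us vs' M) (rect_mat us' vs M) (rect_mat us' vs' M)"
  by (intro eq_matI) (auto simp: rect_mat_def nth_append)

text \<open>The two enumerations differ by a permutation matrix \<open>P\<close> with inverse
  \<open>P'\<close>. This allows the vertices of the join to be listed block by block.\<close>

lemma char_poly_matrix_on_cong_set:
  assumes d: "distinct vs" "distinct ws" and s: "set vs = set ws"
  shows "char_poly (matrix_on vs M) = char_poly (matrix_on ws M)"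
proof -
  have l: "length vs = length ws" using d s by (metis distinct_card)
  define P where "P = rect_mat vs ws (\<lambda>u v. of_bool (u = v))"
  define P' where "P' = rect_mat ws vs (\<lambda>u v. of_bool (u = v))"
  have "similar_mat_wit (matrix_on vs M) (matrix_on ws M) P P'"
  proof (rule similar_mat_witI)
    have "P * P' = rect_mat vs vs (\<lambda>u v. of_bool (u = v))"
      unfolding P_def P'_def rect_mat_mult[OF d(2)]
      using s by (intro rect_mat_cong) (auto simp: of_bool_def if_distrib[of "\<lambda>c. c * _"] cong: if_cong)
    then show "P * P' = 1\<^sub>m (length vs)" by (simp add: rect_mat_one[OF d(1)])
    have "P' * P = rect_mat ws ws (\<lambda>u v. of_bool (u = v))"
      unfolding P_def P'_def rect_mat_mult[OF d(1)]
      using s by (intro rect_mat_cong) (auto simp: of_bool_def if_distrib[of "\<lambda>c. c * _"] cong: if_cong)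
    then show "P' * P = 1\<^sub>m (length vs)" by (simp add: l rect_mat_one[OF d(2)])
    show "matrix_on vs M = P * matrix_on ws M * P'"
      unfolding P_def P'_def matrix_on_eq_rect_mat rect_mat_mult[OF d(2)]
      using s by (intro rect_mat_cong)
        (auto simp: of_bool_def if_distrib[of "\<lambda>c. c * _"] if_distrib[of "\<lambda>c. _ * c"] cong: if_cong)
    show "matrix_on vs M \<in> carrier_mat (length vs) (length vs)" by simp
    show "matrix_on ws M \<in> carrier_mat (length vs) (length vs)" unfolding l by simp
    show "P \<in> carrier_mat (length vs) (length vs)" "P' \<in> carrier_mat (length vs) (length vs)"
      unfolding P_def P'_def carrier_mat_def by (simp_all add: l)
  qed
  then show ?thesis by (intro char_poly_similar) (auto simp: similar_mat_def)
qed

text \<open>The block-constant summand factors as \<open>U * V\<close>, where \<open>U\<close> holds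
  the indicator vectors of the blocks and row \<open>i\<close> of \<open>V\<close> is the constant
  pattern of block \<open>i\<close>. Constant block row sums of \<open>D\<close> say
  \<open>D U = U E\<close>, and \<open>V U\<close> is \<open>b\<close> with columns scaled by block
  sizes.\<close>

lemma char_poly_add_block_constant:
  fixes lab :: "'v \<Rightarrow> nat"
  assumes d: "distinct vs" and lab: "\<And>u. u \<in> set vs \<Longrightarrow> lab u < k"
    and eq: "\<And>u l. u \<in> set vs \<Longrightarrow> l < k \<Longrightarrow> (\<Sum>v | v \<in> set vs \<and> lab v = l. D u v) = E (lab u) l"
  shows "char_poly (matrix_on vs (\<lambda>u v. D u v + b (lab u) (lab v))) * char_poly (matrix_on [0..<k] E) =
    char_poly (matrix_on vs D) *
    char_poly (matrix_on [0..<k] (\<lambda>i j. E i j + b i j * real (card {v \<in> set vs. lab v = j})))"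
proof -
  define U where "U = rect_mat vs [0..<k] (\<lambda>v i. of_bool (lab v = i))"
  define V where "V = rect_mat [0..<k] vs (\<lambda>i v. b i (lab v))"
  have "matrix_on vs D * U = U * matrix_on [0..<k] E"
    unfolding matrix_on_eq_rect_mat U_def rect_mat_mult[OF d] rect_mat_mult[OF distinct_upt]
  proof (intro rect_mat_cong)
    fix u l assume u: "u \<in> set vs" and l: "l \<in> set [0..<k]"
    have "(\<Sum>v\<in>set vs. D u v * of_bool (lab v = l)) = (\<Sum>v | v \<in> set vs \<and> lab v = l. D u v)"
      by (rule sum.mono_neutral_cong_right) auto
    also have "\<dots> = E (lab u) l" using eq u l by simp
    also have "\<dots> = (\<Sum>i\<in>set [0..<k]. of_bool (lab u = i) * E i l)"
      using lab[OF u] by (simp add: of_bool_def if_distrib[of "\<lambda>c. c * _"] sum.delta' sum.delta cong: if_cong)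
    finally show "(\<Sum>v\<in>set vs. D u v * of_bool (lab v = l)) = \<dots>" .
  qed
  moreover have "U \<in> carrier_mat (length vs) k" "V \<in> carrier_mat k (length vs)"
    "matrix_on [0..<k] E \<in> carrier_mat k k"
    by (simp_all add: U_def V_def matrix_on_def rect_mat_def)
  ultimately have "char_poly (matrix_on vs D + U * V) * char_poly (matrix_on [0..<k] E) =
      char_poly (matrix_on vs D) * char_poly (matrix_on [0..<k] E + V * U)"
    by (intro char_poly_add_mult[of _ "length vs" _ k]) simp_all
  moreover have "U * V = rect_mat vs vs (\<lambda>u v. b (lab u) (lab v))"
    unfolding U_def V_def rect_mat_mult[OF distinct_upt]
    by (intro rect_mat_cong)
      (auto simp: of_bool_def if_distrib[of "\<lambda>c. c * _"] sum.delta' sum.delta lab cong: if_cong)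
  moreover have "V * U = rect_mat [0..<k] [0..<k] (\<lambda>i j. b i j * real (card {v \<in> set vs. lab v = j}))"
    unfolding U_def V_def rect_mat_mult[OF d]
  proof (intro rect_mat_cong)
    fix i j
    have "(\<Sum>v\<in>set vs. b i (lab v) * of_bool (lab v = j)) = (\<Sum>v | v \<in> set vs \<and> lab v = j. b i j)"
      by (rule sum.mono_neutral_cong_right) auto
    then show "(\<Sum>v\<in>set vs. b i (lab v) * of_bool (lab v = j)) = b i j * real (card {v \<in> set vs. lab v = j})"
      by simp
  qed
  ultimately show ?thesis by (simp add: matrix_on_eq_rect_mat rect_mat_add)
qed

lemma poly_char_poly_two_by_two:
  "x * poly (char_poly (matrix_on [0, 1] E)) x = x * (x\<^sup>2 - x * E 0 0 - E 0 1 * E 1 0)"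
  if "E 1 1 = 0" for E :: "nat \<Rightarrow> nat \<Rightarrow> real"
proof -
  have "matrix_on [0, 1] E = four_block_mat (rect_mat [0] [0] E) (rect_mat [0] [1] E) (rect_mat [1] [0] E) (0\<^sub>m 1 1)"
    using rect_mat_append[of "[0]" "[1]" "[0]" "[1]" E] rect_mat_zero[of "[1]" "[1]" E] that
    by (simp add: matrix_on_eq_rect_mat)
  moreover have "rect_mat [0] [0] E \<in> carrier_mat 1 1" "rect_mat [0] [1] E \<in> carrier_mat 1 1"
    "rect_mat [1] [0] E \<in> carrier_mat 1 1"
    by (simp_all add: rect_mat_def)
  ultimately have "x * poly (char_poly (matrix_on [0, 1] E)) x =
      x * det (x\<^sup>2 \<cdot>\<^sub>m 1\<^sub>m 1 - x \<cdot>\<^sub>m rect_mat [0] [0] E - rect_mat [0] [1] E * rect_mat [1] [0] E)"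
    using poly_char_poly_four_block_lower_right_zero[of "rect_mat [0] [0] E" 1 "rect_mat [0] [1] E" 1 "rect_mat [1] [0] E" x]
    by simp
  also have "x\<^sup>2 \<cdot>\<^sub>m 1\<^sub>m 1 - x \<cdot>\<^sub>m rect_mat [0] [0] E - rect_mat [0] [1] E * rect_mat [1] [0] E =
      rect_mat [0 :: nat] [0 :: nat] (\<lambda>u v. x\<^sup>2 - x * E 0 0 - E 0 1 * E 1 0)"
    by (intro eq_matI) (auto simp: rect_mat_def scalar_prod_def)
  also have "det \<dots> = x\<^sup>2 - x * E 0 0 - E 0 1 * E 1 0"
    by (subst det_single) (auto simp: rect_mat_def)
  finally show ?thesis .
qed

text \<open>Polynomial functions on an infinite field determine the polynomials, and
  \<open>monom 1 n\<close> is cancellable. This removes the powers of \<open>x\<close> left by the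
  Schur complement.\<close>

lemma poly_eqI_away_from_0:
  fixes p q :: "real poly"
  assumes "\<And>x. x ^ n * poly p x = x ^ n * poly q x"
  shows "p = q"
proof -
  have "poly (monom 1 n * p) x = poly (monom 1 n * q) x" for x
    using assms[of x] by (simp add: poly_monom)
  then have "monom 1 n * p = monom 1 n * q" using poly_eq_poly_eq_iff[of "monom 1 n * p"] by blast
  then show ?thesis by (simp add: monom_eq_0_iff)
qed

section \<open>Translating between characteristic polynomials and eigenvalue multisets\<close>

lemma map_poly_of_real_prod_linear:
  "map_poly complex_of_real (\<Prod>l\<in>#S. [:- l, 1:]) = (\<Prod>l\<in>#S. [:- of_real l, 1:])"
proof -
  interpret p: map_poly_comm_ring_hom complex_of_real ..
  show ?thesis by (induction S) (simp_all add: p.hom_mult del: mult_pCons_left)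
qed

text \<open>Over the complex numbers a monic polynomial is recovered from its roots; the
  factorization descends because the coefficient embedding is injective.\<close>

lemma char_poly_real_eigenvalues:
  assumes A: "A \<in> carrier_mat n n" and eig: "eigenvalues A = image_mset complex_of_real S"
  shows "char_poly A = (\<Prod>l\<in>#S. [:- l, 1:])"
proof -
  let ?c = "map_poly complex_of_real"
  interpret p: map_poly_inj_comm_ring_hom complex_of_real ..
  have cA: "map_mat complex_of_real A \<in> carrier_mat n n" using A by simp
  have prod: "?c (\<Prod>l\<in>#S. [:- l, 1:]) = (\<Prod>l\<in>#S. [:- of_real l, 1:])"
    by (rule map_poly_of_real_prod_linear)
  have "?c (char_poly A) = char_poly (map_mat complex_of_real A)"
    by (rule of_real_hom.char_poly_hom[OF A, symmetric])
  also have "\<dots> = (\<Prod>l\<in>#image_mset complex_of_real S. [:- l, 1:])"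
    using complex_poly_decompose_multiset[of "char_poly (map_mat complex_of_real A)"]
      degree_monic_char_poly[OF cA] eig by (simp add: eigenvalues_def)
  also have "\<dots> = ?c (\<Prod>l\<in>#S. [:- l, 1:])" by (simp add: prod image_mset.compositionality o_def)
  finally show ?thesis by (rule p.injectivity)
qed

text \<open>Only the explicitly known factor is split over the reals; the roots of the other one,
  later the quotient matrix, stay a complex multiset.\<close>

lemma eigenvalues_char_poly_mult:
  assumes A: "A \<in> carrier_mat n n" and B: "B \<in> carrier_mat m m"
    and cp: "char_poly A = (\<Prod>l\<in>#S. [:- l, 1:]) * char_poly B"
  shows "eigenvalues A = image_mset complex_of_real S + eigenvalues B"
proof -
  let ?c = "map_poly complex_of_real"
  have prod: "?c (\<Prod>l\<in>#S. [:- l, 1:]) = (\<Prod>l\<in>#S. [:- of_real l, 1:])"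
    by (rule map_poly_of_real_prod_linear)
  interpret p: map_poly_comm_ring_hom complex_of_real ..
  have "char_poly (map_mat complex_of_real A) = ?c (char_poly A)"
    by (rule of_real_hom.char_poly_hom[OF A])
  also have "\<dots> = (\<Prod>l\<in>#S. [:- of_real l, 1:]) * char_poly (map_mat complex_of_real B)"
    unfolding cp of_real_hom.char_poly_hom[OF B] p.hom_mult prod ..
  finally have eq: "char_poly (map_mat complex_of_real A) =
    (\<Prod>l\<in>#S. [:- of_real l, 1:]) * char_poly (map_mat complex_of_real B)" .
  have "char_poly (map_mat complex_of_real B) \<noteq> 0"
    using degree_monic_char_poly[of "map_mat complex_of_real B" m] B by auto
  moreover have "(\<Prod>l\<in>#S. [:- complex_of_real l, 1:]) \<noteq> 0"
    by (rule prod_mset_linear_neq_0)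
  moreover have "proots (\<Prod>l\<in>#S. [:- complex_of_real l, 1:]) = image_mset complex_of_real S"
  proof (induction S)
    case (add x S)
    then show ?case
      by (simp add: proots_mult prod_mset_linear_neq_0[of complex_of_real] del: mult_pCons_left prod_mset_zero_iff)
  qed simp
  ultimately show ?thesis unfolding eigenvalues_def eq by (simp add: proots_mult del: prod_mset_zero_iff)
qed

section \<open>Distances, incidences and eigenvalues in regular graphs\<close>

text \<open>A function that grows by at most one along arcs bounds the distance from below; predecessors
  at which it is smaller by one provide walks that attain the bound.\<close>

lemma gdist_eqI:
  fixes G :: "'a pair_pre_digraph" and d :: "'a \<Rightarrow> 'a \<Rightarrow> nat"
  assumes G: "pair_wf_digraph G"
    and refl: "\<And>u. u \<in> pverts G \<Longrightarrow> d u u = 0"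
    and step: "\<And>u x y. u \<in> pverts G \<Longrightarrow> (x, y) \<in> parcs G \<Longrightarrow> d u y \<le> d u x + 1"
    and pred: "\<And>u v. u \<in> pverts G \<Longrightarrow> v \<in> pverts G \<Longrightarrow> u \<noteq> v \<Longrightarrow>
      \<exists>x. (x, v) \<in> parcs G \<and> d u v = d u x + 1"
    and uv: "u \<in> pverts G" "v \<in> pverts G"
  shows "gdist G u v = d u v"
proof -
  interpret pair_wf_digraph G by (rule G)
  have lower: "d u y \<le> d u x + length p" if "awalk x p y" for x p y
    using that
  proof (induction p arbitrary: x)
    case Nil
    then show ?case by (simp add: awalk_Nil_iff)
  next
    case (Cons e p)
    then have "e \<in> parcs G" "fst e = x" "awalk (snd e) p y" by (simp_all add: awalk_Cons_iff)
    then have "d u y \<le> d u (snd e) + length p" "d u (snd e) \<le> d u x + 1"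
      using Cons.IH step[of u x "snd e"] uv(1) by auto
    then show ?case by simp
  qed
  have ex: "\<exists>p. awalk u p v \<and> length p = d u v"
    using uv(2)
  \<comment> \<open>Descends along the predecessors from \<open>pred\<close>, building the walk from
    its last arc backwards.\<close>
  proof (induction "d u v" arbitrary: v rule: less_induct)
    case less
    show ?case
    proof (cases "u = v")
      case True
      then have "awalk u [] v" using uv(1) by (simp add: awalk_Nil_iff)
      then show ?thesis using refl[OF uv(1)] True by (intro exI[of _ "[]"]) simp
    next
      case False
      then obtain x where x: "(x, v) \<in> parcs G" "d u v = d u x + 1"
        using pred[OF uv(1) less.prems] by blast
      then have "x \<in> pverts G" by (simp add: in_arcsD1)
      then obtain p where "awalk u p x" "length p = d u x"
        using less.hyps[of x] x by auto
      moreover have "awalk x [(x, v)] v" using arc_implies_awalk[OF x(1)] by simp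
      ultimately have "awalk u (p @ [(x, v)]) v" by (meson awalk_appendI)
      then show ?thesis using \<open>length p = d u x\<close> x(2) by (intro exI[of _ "p @ [(x, v)]"]) simp
    qed
  qed
  have cost: "awalk_cost (\<lambda>_. 1) p = real (length p)" for p :: "('a \<times> 'a) list"
    by (induction p) auto
  have "\<mu> (\<lambda>_. 1) u v = ereal (d u v)"
  proof (rule antisym)
    obtain p where p: "awalk u p v" "length p = d u v" using ex by blast
    show "\<mu> (\<lambda>_. 1) u v \<le> ereal (d u v)"
      using min_cost_le_walk_cost[OF p(1), of "\<lambda>_. 1"] p(2) by (simp add: cost)
    show "ereal (d u v) \<le> \<mu> (\<lambda>_. 1) u v"
      unfolding \<mu>_def using lower[of u _ v] refl[OF uv(1)] by (auto intro!: INF_greatest simp: cost)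
  qed
  then show ?thesis by (simp add: gdist_def)
qed

section \<open>Counting edges and neighbours\<close>

context pair_graph
begin

lemma arc_sym: "(u, v) \<in> parcs G \<Longrightarrow> (v, u) \<in> parcs G"
  using pair_sym_arcs by (auto simp: symmetric_def symD)

lemma arc_neq: "(u, v) \<in> parcs G \<Longrightarrow> u \<noteq> v"
  using pair_no_loops by fastforce

lemma doubleton_in_edges_iff: "{u, v} \<in> edges G \<longleftrightarrow> (u, v) \<in> parcs G"
  by (auto simp: edges_def doubleton_eq_iff intro: arc_sym)

lemma edgesE:
  assumes "e \<in> edges G"
  obtains u v where "e = {u, v}" "u \<noteq> v" "u \<in> pverts G" "v \<in> pverts G" "(u, v) \<in> parcs G"
  using assms arc_neq in_arcsD1 in_arcsD2 unfolding edges_def by blast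

lemma edge_card: "e \<in> edges G \<Longrightarrow> card e = 2"
  by (auto elim: edgesE)

lemma edge_subset: "e \<in> edges G \<Longrightarrow> e \<subseteq> pverts G"
  by (auto elim: edgesE)

lemma finite_edges: "finite (edges G)"
  by (rule finite_subset[of _ "Pow (pverts G)"]) (use edge_subset pair_finite_verts in auto)

text \<open>In a simple graph two distinct ends determine the edge. This yields the off-diagonal
  entries of \<open>R R^T\<close>.\<close>

lemma edges_containing_both:
  assumes "u \<noteq> v"
  shows "{e \<in> edges G. u \<in> e \<and> v \<in> e} = (if (u, v) \<in> parcs G then {{u, v}} else {})"
proof -
  have "(e \<in> edges G \<and> u \<in> e \<and> v \<in> e) = (e \<in> edges G \<and> e = {u, v})" for e
  proof (cases "e \<in> edges G")
    case True
    then obtain a b where "e = {a, b}" by (rule edgesE)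
    then show ?thesis using assms True by auto
  qed simp
  then have "{e \<in> edges G. u \<in> e \<and> v \<in> e} = {e \<in> edges G. e = {u, v}}"
    by (simp only:)
  also have "\<dots> = (if {u, v} \<in> edges G then {{u, v}} else {})" by auto
  finally show ?thesis by (simp only: doubleton_in_edges_iff)
qed

text \<open>Double counting of incidences: each edge is seen from its two ends.\<close>

lemma sum_card_incident_edges: "(\<Sum>v\<in>pverts G. card {e \<in> edges G. v \<in> e}) = 2 * card (edges G)"
proof -
  have "(\<Sum>v\<in>pverts G. card {e \<in> edges G. v \<in> e}) = (\<Sum>v\<in>pverts G. \<Sum>e\<in>edges G. of_bool (v \<in> e))"
    using finite_edges by (simp add: Int_def)
  also have "\<dots> = (\<Sum>e\<in>edges G. \<Sum>v\<in>pverts G. of_bool (v \<in> e))" by (rule sum.swap)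
  also have "\<dots> = (\<Sum>e\<in>edges G. 2)"
  proof (rule sum.cong[OF refl])
    fix e assume e: "e \<in> edges G"
    have "(\<Sum>v\<in>pverts G. of_bool (v \<in> e)) = card e"
      using edge_subset[OF e] pair_finite_verts by (simp add: Int_absorb1)
    then show "(\<Sum>v\<in>pverts G. of_bool (v \<in> e)) = (2 :: nat)" using edge_card[OF e] by simp
  qed
  finally show ?thesis by simp
qed

context
  fixes r :: nat
  assumes r: "regular G r"
begin

lemma card_neighbours: "v \<in> pverts G \<Longrightarrow> card {u \<in> pverts G. (v, u) \<in> parcs G} = r"
proof -
  assume v: "v \<in> pverts G"
  have "out_arcs G v = Pair v ` {u \<in> pverts G. (v, u) \<in> parcs G}"
    by (auto simp: out_arcs_def in_arcsD2)
  then have "card (out_arcs G v) = card {u \<in> pverts G. (v, u) \<in> parcs G}"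
    by (simp add: card_image inj_on_def)
  then show ?thesis using r v by (simp add: regular_def out_degree_def)
qed

text \<open>The form in which \<open>r1 \<ge> 2\<close> enters the eccentricity bounds: one
  prescribed vertex \<open>w\<close> can always be avoided.\<close>

lemma neighbour_neqE:
  assumes "2 \<le> r" "v \<in> pverts G"
  obtains u where "(v, u) \<in> parcs G" "u \<noteq> w"
proof -
  have "\<not> {u \<in> pverts G. (v, u) \<in> parcs G} \<subseteq> {w}"
  proof
    assume "{u \<in> pverts G. (v, u) \<in> parcs G} \<subseteq> {w}"
    then have "card {u \<in> pverts G. (v, u) \<in> parcs G} \<le> 1"
      using card_mono[of "{w}"] by fastforce
    then show False using card_neighbours[OF assms(2)] assms(1) by simp
  qed
  then show ?thesis using that by blast
qed

lemma incident_edgeE: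
  assumes "2 \<le> r" "v \<in> pverts G"
  obtains e where "e \<in> edges G" "v \<in> e"
proof -
  obtain u where "(v, u) \<in> parcs G" by (rule neighbour_neqE[OF assms])
  then show ?thesis using that[of "{v, u}"] by (simp add: doubleton_in_edges_iff)
qed

lemma card_incident_edges:
  assumes "v \<in> pverts G"
  shows "card {e \<in> edges G. v \<in> e} = r"
proof -
  have "{e \<in> edges G. v \<in> e} = (\<lambda>u. {v, u}) ` {u \<in> pverts G. (v, u) \<in> parcs G}"
    by (auto elim!: edgesE simp: doubleton_in_edges_iff insert_commute image_iff intro: arc_sym) 
  moreover have "inj_on (\<lambda>u. {v, u}) {u \<in> pverts G. (v, u) \<in> parcs G}"
    by (auto simp: inj_on_def doubleton_eq_iff)
  ultimately show ?thesis using card_neighbours[OF assms] by (simp add: card_image)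
qed

lemma handshake: "r * card (pverts G) = 2 * card (edges G)"
  using sum_card_incident_edges by (simp add: card_incident_edges mult.commute)

lemma sum_adjacency_entry: "v \<in> pverts G \<Longrightarrow> (\<Sum>u\<in>pverts G. adjacency_entry G v u) = r"
  using card_neighbours[of v] pair_finite_verts by (simp add: adjacency_entry_def sum.If_cases Int_def)

text \<open>The entrywise form of \<open>R R^T = A + r I\<close>: the sum counts edges containing
  both \<open>u\<close> and \<open>v\<close>, which are the \<open>r\<close> edges at
  \<open>u\<close> if \<open>u = v\<close>, and at most one otherwise.\<close>

lemma sum_incidence_products:
  assumes "u \<in> pverts G"
  shows "(\<Sum>e\<in>edges G. of_bool (u \<in> e) * of_bool (v \<in> e)) = adjacency_entry G u v + real r * of_bool (u = v)"
proof -
  have "(\<Sum>e\<in>edges G. of_bool (u \<in> e) * of_bool (v \<in> e)) = real (card {e \<in> edges G. u \<in> e \<and> v \<in> e})"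
    using finite_edges by (simp add: Int_def flip: of_bool_conj)
  then show ?thesis
    using edges_containing_both[of u v] card_incident_edges[OF assms] arc_neq[of u u]
    by (cases "u = v") (auto simp: adjacency_entry_def)
qed

text \<open>At a coordinate \<open>i\<close> of maximal modulus the eigenvector equation gives
  \<open>\<bar>l\<bar> \<bar>x $ i\<bar> \<le> r \<bar>x $ i\<bar>\<close>. The bound makes the
  radicands in the spectrum nonnegative.\<close>

lemma adjacency_eigenvalue_ge:
  assumes vs: "distinct vs" "set vs = pverts G" and ev: "eigenvalue (adjacency_matrix vs G) l"
  shows "- real r \<le> l"
proof -
  define n where "n = length vs"
  obtain x where x: "x \<in> carrier_vec n" "x \<noteq> 0\<^sub>v n" and Ax: "adjacency_matrix vs G *\<^sub>v x = l \<cdot>\<^sub>v x"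
    using ev by (auto simp: eigenvalue_def eigenvector_def n_def adjacency_matrix_def matrix_on_def)
  then obtain j where j: "j < n" "x $ j \<noteq> 0" by (metis eq_vecI carrier_vecD index_zero_vec)
  have "\<exists>i\<in>{..<n}. \<forall>k\<in>{..<n}. \<bar>x $ k\<bar> \<le> \<bar>x $ i\<bar>"
    using Max_in[of "(\<lambda>k. \<bar>x $ k\<bar>) ` {..<n}"] Max_ge[of "(\<lambda>k. \<bar>x $ k\<bar>) ` {..<n}"] j(1)
    by (smt (verit, best) empty_iff finite_imageI finite_lessThan image_iff imageI lessThan_iff)
  then obtain i where i: "i < n" and max: "\<And>k. k < n \<Longrightarrow> \<bar>x $ k\<bar> \<le> \<bar>x $ i\<bar>"
    by (auto simp: lessThan_iff)
  let ?a = "\<lambda>k. adjacency_entry G (vs ! i) (vs ! k)"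
  have "l * x $ i = (\<Sum>k = 0..<n. ?a k * x $ k)"
    using arg_cong[OF Ax, of "\<lambda>v. v $ i"] i x(1)
    by (simp add: adjacency_matrix_def matrix_on_def n_def scalar_prod_def)
  then have "\<bar>l\<bar> * \<bar>x $ i\<bar> \<le> (\<Sum>k = 0..<n. \<bar>?a k * x $ k\<bar>)"
    by (metis abs_mult sum_abs)
  also have "\<dots> \<le> (\<Sum>k = 0..<n. ?a k * \<bar>x $ i\<bar>)"
    using max by (intro sum_mono) (auto simp: adjacency_entry_def)
  also have "\<dots> = (\<Sum>k = 0..<n. ?a k) * \<bar>x $ i\<bar>" by (simp add: sum_distrib_right)
  also have "(\<Sum>k = 0..<n. ?a k) = (\<Sum>u\<in>set vs. adjacency_entry G (vs ! i) u)"
    using sum.reindex_bij_betw[OF bij_betw_nth[OF vs(1) refl refl], of "adjacency_entry G (vs ! i)"]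
    by (simp add: n_def atLeast0LessThan)
  also have "\<dots> = r"
    using sum_adjacency_entry[of "vs ! i"] i vs(2) nth_mem[of i vs] by (simp add: n_def)
  finally have "\<bar>l\<bar> * \<bar>x $ i\<bar> \<le> real r * \<bar>x $ i\<bar>" .
  \<comment> \<open>The nonzero coordinate \<open>j\<close> is dominated by coordinate
    \<open>i\<close>, so \<open>\<bar>x $ i\<bar>\<close> can be cancelled.\<close>
  moreover have "0 < \<bar>x $ i\<bar>" using j max[OF j(1)] by simp
  ultimately show ?thesis by simp
qed

end

end

section \<open>The eccentricity matrix of the join\<close>

text \<open>Any two subdivision vertices meet at a vertex of \<open>G2\<close>, and any two vertices
  of \<open>G2\<close> at a subdivision vertex. The values 3 and 4 come from detours through
  \<open>V(G2)\<close>: vertex, edge, \<open>V(G2)\<close>, edge, and possibly one more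
  vertex.\<close>

fun join_dist :: "'a pair_pre_digraph \<Rightarrow> 'b pair_pre_digraph \<Rightarrow>
    ('a + 'a set) + 'b \<Rightarrow> ('a + 'a set) + 'b \<Rightarrow> nat" where
  "join_dist G1 G2 (Inl (Inl u)) (Inl (Inl v)) = (if u = v then 0 else if (u, v) \<in> parcs G1 then 2 else 4)"
| "join_dist G1 G2 (Inl (Inl u)) (Inl (Inr e)) = (if u \<in> e then 1 else 3)"
| "join_dist G1 G2 (Inl (Inl u)) (Inr w) = 2"
| "join_dist G1 G2 (Inl (Inr e)) (Inl (Inl u)) = (if u \<in> e then 1 else 3)"
| "join_dist G1 G2 (Inl (Inr e)) (Inl (Inr f)) = (if e = f then 0 else 2)"
| "join_dist G1 G2 (Inl (Inr e)) (Inr w) = 1"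
| "join_dist G1 G2 (Inr w) (Inl (Inl u)) = 2"
| "join_dist G1 G2 (Inr w) (Inl (Inr e)) = 1"
| "join_dist G1 G2 (Inr w) (Inr x) = (if w = x then 0 else if (w, x) \<in> parcs G2 then 1 else 2)"

text \<open>The labels are the positions in \<open>join_blocks\<close>.\<close>

fun join_block :: "('a + 'a set) + 'b \<Rightarrow> nat" where
  "join_block (Inl (Inl u)) = 0"
| "join_block (Inl (Inr e)) = 1"
| "join_block (Inr w) = 2"

text \<open>The generic entry of each block: the distance of nonadjacent or nonincident vertices
  where it equals the smaller eccentricity. It is 0 on \<open>I(G1) \<times> I(G1)\<close> and
  \<open>I(G1) \<times> V(G2)\<close>, where distances are at most 2 and 1, but the smaller
  eccentricity is 3 and 2.\<close>

definition block_weight :: "nat \<Rightarrow> nat \<Rightarrow> real" where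
  "block_weight i j = [[4, 3, 2], [3, 0, 0], [2, 0, 2]] ! i ! j"

text \<open>What is left of the eccentricity matrix after subtracting \<open>4 J\<close>, \<open>3 J\<close>, \<open>2 J\<close> in the blocks
  \<open>V(G1) \<times> V(G1)\<close>, \<open>V(G1) \<times> I(G1)\<close>, \<open>V(G1) \<times> V(G2)\<close> and their transposes, and \<open>2 J\<close> in
  \<open>V(G2) \<times> V(G2)\<close>.\<close>

fun join_core :: "'a pair_pre_digraph \<Rightarrow> 'b pair_pre_digraph \<Rightarrow>
    ('a + 'a set) + 'b \<Rightarrow> ('a + 'a set) + 'b \<Rightarrow> real" where
  "join_core G1 G2 (Inl (Inl u)) (Inl (Inl v)) = - 4 * (of_bool (u = v) + adjacency_entry G1 u v)"
| "join_core G1 G2 (Inl (Inl u)) (Inl (Inr e)) = - 3 * of_bool (u \<in> e)"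
| "join_core G1 G2 (Inl (Inr e)) (Inl (Inl u)) = - 3 * of_bool (u \<in> e)"
| "join_core G1 G2 (Inr w) (Inr x) = - 2 * (of_bool (w = x) + adjacency_entry G2 w x)"
| "join_core G1 G2 _ _ = 0"

text \<open>Block row sums of \<open>join_core\<close>: the entry \<open>- 3 * real r1\<close>
  counts the edges at a vertex, \<open>- 6\<close> the two ends of an edge.\<close>

definition join_core_quotient :: "nat \<Rightarrow> nat \<Rightarrow> nat \<Rightarrow> nat \<Rightarrow> real" where
  "join_core_quotient r1 r2 i j =
    [[- 4 * (1 + real r1), - 3 * real r1, 0], [- 6, 0, 0], [0, 0, - 2 * (1 + real r2)]] ! i ! j"

lemma pverts_join:
  "pverts (subdivision_edge_join G1 G2) =
    (Inl \<circ> Inl) ` pverts G1 \<union> (Inl \<circ> Inr) ` edges G1 \<union> Inr ` pverts G2"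
  by (auto simp: subdivision_edge_join_def subdivision_graph_def Plus_def image_iff)

lemma parcs_join:
  "(Inl (Inl u), Inl (Inl v)) \<notin> parcs (subdivision_edge_join G1 G2)"
  "(Inl (Inl u), Inl (Inr e)) \<in> parcs (subdivision_edge_join G1 G2) \<longleftrightarrow> e \<in> edges G1 \<and> u \<in> e"
  "(Inl (Inr e), Inl (Inl u)) \<in> parcs (subdivision_edge_join G1 G2) \<longleftrightarrow> e \<in> edges G1 \<and> u \<in> e"
  "(Inl (Inr e), Inl (Inr f)) \<notin> parcs (subdivision_edge_join G1 G2)"
  "(Inl (Inl u), Inr w) \<notin> parcs (subdivision_edge_join G1 G2)"
  "(Inr w, Inl (Inl u)) \<notin> parcs (subdivision_edge_join G1 G2)"
  "(Inl (Inr e), Inr w) \<in> parcs (subdivision_edge_join G1 G2) \<longleftrightarrow> e \<in> edges G1 \<and> w \<in> pverts G2"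
  "(Inr w, Inl (Inr e)) \<in> parcs (subdivision_edge_join G1 G2) \<longleftrightarrow> e \<in> edges G1 \<and> w \<in> pverts G2"
  "(Inr w, Inr x) \<in> parcs (subdivision_edge_join G1 G2) \<longleftrightarrow> (w, x) \<in> parcs G2"
  by (auto simp: subdivision_edge_join_def subdivision_graph_def)

lemma join_vertex_cases:
  assumes "x \<in> pverts (subdivision_edge_join G1 G2)"
  obtains (vertex) u where "x = Inl (Inl u)" "u \<in> pverts G1"
  | (edge) e where "x = Inl (Inr e)" "e \<in> edges G1"
  | (right) w where "x = Inr w" "w \<in> pverts G2"
  using assms by (auto simp: pverts_join)

lemma join_vertex_iff:
  "Inl (Inl u) \<in> pverts (subdivision_edge_join G1 G2) \<longleftrightarrow> u \<in> pverts G1"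
  "Inl (Inr e) \<in> pverts (subdivision_edge_join G1 G2) \<longleftrightarrow> e \<in> edges G1"
  "Inr w \<in> pverts (subdivision_edge_join G1 G2) \<longleftrightarrow> w \<in> pverts G2"
  by (auto simp: pverts_join)

text \<open>Nonemptiness supplies intermediate vertices for shortest walks and keeps all three
  blocks inhabited.\<close>

locale regular_join = G1: pair_graph G1 + G2: pair_graph G2
  for G1 :: "'a pair_pre_digraph" and G2 :: "'b pair_pre_digraph" +
  fixes r1 r2 :: nat
  assumes regular1: "regular G1 r1" and regular2: "regular G2 r2" and r1: "2 \<le> r1"
    and nonempty1: "pverts G1 \<noteq> {}" and nonempty2: "pverts G2 \<noteq> {}"
begin

abbreviation H :: "(('a + 'a set) + 'b) pair_pre_digraph" where
  "H \<equiv> subdivision_edge_join G1 G2"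

lemma finite_pverts_join: "finite (pverts H)"
  by (simp add: pverts_join G1.finite_edges G1.pair_finite_verts G2.pair_finite_verts)

lemma edge_arc: "e \<in> edges G1 \<Longrightarrow> u \<in> e \<Longrightarrow> v \<in> e \<Longrightarrow> u = v \<or> (u, v) \<in> parcs G1"
  using G1.edges_containing_both[of u v] by (cases "(u, v) \<in> parcs G1") auto

lemma pair_wf_join: "pair_wf_digraph H"
proof
  have "x \<in> pverts H \<and> y \<in> pverts H" if "(x, y) \<in> parcs H" for x y
  proof -
    obtain u e w where "x = Inl (Inl u) \<or> x = Inl (Inr e) \<or> x = Inr w" by (metis sumE)
    moreover obtain u' e' w' where "y = Inl (Inl u') \<or> y = Inl (Inr e') \<or> y = Inr w'" by (metis sumE)
    ultimately show ?thesis
      using that G1.edge_subset[THEN subsetD] G2.in_arcsD1 G2.in_arcsD2 by (auto simp: parcs_join join_vertex_iff)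
  qed
  then show "fst a \<in> pverts H" "snd a \<in> pverts H" if "a \<in> parcs H" for a
    using that by (cases a; simp)+
qed

lemma gdist_join:
  assumes "x \<in> pverts H" "y \<in> pverts H"
  shows "gdist H x y = join_dist G1 G2 x y"
proof (rule gdist_eqI[OF pair_wf_join _ _ _ assms])
  show "join_dist G1 G2 x x = 0" for x
    by (cases x rule: join_block.cases) auto
next
  fix u x y assume "(x, y) \<in> parcs H"
  \<comment> \<open>The delicate case leaves a subdivision vertex \<open>e\<close> containing
    \<open>u\<close>: the other end of \<open>e\<close> is adjacent to \<open>u\<close> by
    \<open>edge_arc\<close>, so its value is 2 and not 4.\<close>
  then show "join_dist G1 G2 u y \<le> join_dist G1 G2 u x + 1"
    using edge_arc G2.arc_sym
    by (cases u rule: join_block.cases; cases x rule: join_block.cases; cases y rule: join_block.cases)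
      (auto simp: parcs_join)
next
  fix x y assume x: "x \<in> pverts H" and y: "y \<in> pverts H" and neq: "x \<noteq> y"
  obtain w0 where w0: "w0 \<in> pverts G2" using nonempty2 by blast
  obtain e0 where e0: "e0 \<in> edges G1"
    using nonempty1 G1.incident_edgeE[OF regular1 r1] by blast
  show "\<exists>z. (z, y) \<in> parcs H \<and> join_dist G1 G2 x y = join_dist G1 G2 x z + 1"
    using y
  proof (cases rule: join_vertex_cases)
    case (vertex v)
    obtain f where f: "f \<in> edges G1" "v \<in> f"
      using G1.incident_edgeE[OF regular1 r1 vertex(2)] by blast
    show ?thesis using x
    proof (cases rule: join_vertex_cases)
      case (vertex u)
      show ?thesis
      proof (cases "(u, v) \<in> parcs G1")
        case True
        then have "{u, v} \<in> edges G1" by (simp add: G1.doubleton_in_edges_iff)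
        then show ?thesis using True vertex \<open>y = Inl (Inl v)\<close> neq
          by (intro exI[of _ "Inl (Inr {u, v})"]) (auto simp: parcs_join)
      next
        case False
        \<comment> \<open>An edge containing both vertices would make them adjacent, so every edge
          at \<open>v\<close> has value 3 from \<open>u\<close>.\<close>
        then have "u \<notin> f" using edge_arc[OF f(1) _ f(2)] neq vertex \<open>y = Inl (Inl v)\<close> by auto
        then show ?thesis using False vertex \<open>y = Inl (Inl v)\<close> neq f
          by (intro exI[of _ "Inl (Inr f)"]) (auto simp: parcs_join)
      qed
    next
      case (edge e)
      \<comment> \<open>If \<open>v\<close> lies on \<open>e\<close>, then \<open>e\<close> itself
        precedes \<open>v\<close>; otherwise any edge \<open>f\<close> at \<open>v\<close> differs
        from \<open>e\<close> and has value 2.\<close>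
      then show ?thesis using \<open>y = Inl (Inl v)\<close> f
        by (intro exI[of _ "Inl (Inr (if v \<in> e then e else f))"]) (auto simp: parcs_join)
    next
      case (right w)
      then show ?thesis using \<open>y = Inl (Inl v)\<close> f
        by (intro exI[of _ "Inl (Inr f)"]) (auto simp: parcs_join)
    qed
  next
    case (edge f)
    show ?thesis using x
    proof (cases rule: join_vertex_cases)
      case (vertex u)
      then show ?thesis using edge w0
        by (intro exI[of _ "if u \<in> f then Inl (Inl u) else Inr w0"]) (auto simp: parcs_join)
    next
      case (edge e)
      then show ?thesis using \<open>y = Inl (Inr f)\<close> \<open>f \<in> edges G1\<close> neq w0
        by (intro exI[of _ "Inr w0"]) (auto simp: parcs_join)
    next
      case (right w)
      then show ?thesis using edge
        by (intro exI[of _ "Inr w"]) (auto simp: parcs_join)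
    qed
  next
    case (right w)
    show ?thesis using x
    proof (cases rule: join_vertex_cases)
      case (vertex u)
      obtain e where "e \<in> edges G1" "u \<in> e"
        using G1.incident_edgeE[OF regular1 r1 vertex(2)] by blast
      then show ?thesis using vertex right
        by (intro exI[of _ "Inl (Inr e)"]) (auto simp: parcs_join)
    next
      case (edge e)
      then show ?thesis using right
        by (intro exI[of _ "Inl (Inr e)"]) (auto simp: parcs_join)
    next
      case (right w')
      then show ?thesis using \<open>y = Inr w\<close> \<open>w \<in> pverts G2\<close> neq e0
        by (intro exI[of _ "if (w', w) \<in> parcs G2 then Inr w' else Inl (Inr e0)"]) (auto simp: parcs_join)
    qed
  qed
qed

section \<open>Eccentricities and matrix entries of the join\<close>

lemma eccentricity_join_le:
  assumes "x \<in> pverts H" and "\<And>y. y \<in> pverts H \<Longrightarrow> join_dist G1 G2 x y \<le> k"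
  shows "eccentricity H x \<le> real k"
  using assms finite_pverts_join unfolding eccentricity_def
  by (subst Max_le_iff) (auto simp: gdist_join)

lemma eccentricity_join_ge:
  assumes "x \<in> pverts H" "y \<in> pverts H" and "k \<le> join_dist G1 G2 x y"
  shows "real k \<le> eccentricity H x"
proof -
  have "gdist H x y \<le> eccentricity H x"
    unfolding eccentricity_def using assms finite_pverts_join by (intro Max_ge) auto
  then show ?thesis using assms by (simp add: gdist_join)
qed

text \<open>A walk \<open>u\<close>, \<open>v\<close>, \<open>w\<close> with
  \<open>w \<noteq> u\<close> ends in an edge \<open>{v, w}\<close> that misses \<open>u\<close>,
  hence lies at distance 3. Only a bound is claimed, since the value may be 3 or 4.\<close>

lemma eccentricity_vertex_ge:
  assumes u: "u \<in> pverts G1"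
  shows "3 \<le> eccentricity H (Inl (Inl u))"
proof -
  obtain v where v: "(u, v) \<in> parcs G1"
    using G1.neighbour_neqE[OF regular1 r1 u] by blast
  obtain w where w: "(v, w) \<in> parcs G1" "w \<noteq> u"
    using G1.neighbour_neqE[OF regular1 r1 G1.in_arcsD2[OF v]] by blast
  then have "{v, w} \<in> edges G1" "u \<notin> {v, w}"
    using G1.arc_neq[OF v] by (auto simp: G1.doubleton_in_edges_iff)
  then show ?thesis
    using eccentricity_join_ge[of "Inl (Inl u)" "Inl (Inr {v, w})" 3] u by (simp add: join_vertex_iff)
qed

lemma eccentricity_vertex_nonadjacent:
  assumes u: "u \<in> pverts G1" and v: "v \<in> pverts G1" "u \<noteq> v" "(u, v) \<notin> parcs G1"
  shows "eccentricity H (Inl (Inl u)) = 4"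
proof (rule antisym)
  have "eccentricity H (Inl (Inl u)) \<le> real 4"
    using u by (intro eccentricity_join_le) (auto simp: join_vertex_iff elim!: join_vertex_cases)
  then show "eccentricity H (Inl (Inl u)) \<le> 4" by simp
  show "4 \<le> eccentricity H (Inl (Inl u))"
    using eccentricity_join_ge[of "Inl (Inl u)" "Inl (Inl v)" 4] assms by (simp add: join_vertex_iff)
qed

lemma eccentricity_edge:
  assumes e: "e \<in> edges G1"
  shows "eccentricity H (Inl (Inr e)) = 3"
proof (rule antisym)
  have "eccentricity H (Inl (Inr e)) \<le> real 3"
    using e by (intro eccentricity_join_le) (auto simp: join_vertex_iff elim!: join_vertex_cases)
  then show "eccentricity H (Inl (Inr e)) \<le> 3" by simp
  obtain u v where uv: "e = {u, v}" "u \<in> pverts G1"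
    using G1.edgesE[OF e] by blast
  \<comment> \<open>A second neighbour of an end of \<open>e\<close> is a vertex off
    \<open>e\<close>, at distance 3.\<close>
  obtain w where w: "(u, w) \<in> parcs G1" "w \<noteq> v"
    using G1.neighbour_neqE[OF regular1 r1 uv(2)] by blast
  then have "w \<notin> e" using uv G1.arc_neq[OF w(1)] by auto
  then show "3 \<le> eccentricity H (Inl (Inr e))"
    using eccentricity_join_ge[of "Inl (Inr e)" "Inl (Inl w)" 3] e G1.in_arcsD2[OF w(1)]
    by (simp add: join_vertex_iff)
qed

lemma eccentricity_right:
  assumes w: "w \<in> pverts G2"
  shows "eccentricity H (Inr w) = 2"
proof (rule antisym)
  have "eccentricity H (Inr w) \<le> real 2"
    using w by (intro eccentricity_join_le) (auto simp: join_vertex_iff elim!: join_vertex_cases)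
  then show "eccentricity H (Inr w) \<le> 2" by simp
  obtain u where "u \<in> pverts G1" using nonempty1 by blast
  then show "2 \<le> eccentricity H (Inr w)"
    using eccentricity_join_ge[of "Inr w" "Inl (Inl u)" 2] w by (simp add: join_vertex_iff)
qed

text \<open>Only \<open>V(G1) \<times> V(G1)\<close> needs care, because the eccentricity varies
  there. On equal or adjacent vertices the distance stays below 3; on the remaining pairs both
  eccentricities are 4.\<close>

lemma eccentricity_entry_join:
  assumes x: "x \<in> pverts H" and y: "y \<in> pverts H"
  shows "eccentricity_entry H x y = join_core G1 G2 x y + block_weight (join_block x) (join_block y)"
proof -
  have vv: "eccentricity_entry H (Inl (Inl u)) (Inl (Inl v)) =
      join_core G1 G2 (Inl (Inl u)) (Inl (Inl v)) + 4" if u: "u \<in> pverts G1" and v: "v \<in> pverts G1" for u v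
  proof (cases "u = v \<or> (u, v) \<in> parcs G1")
    case True
    then show ?thesis
      using eccentricity_vertex_ge[OF u] eccentricity_vertex_ge[OF v] u v G1.arc_neq[of u u]
      by (auto simp: eccentricity_entry_def gdist_join join_vertex_iff adjacency_entry_def min_def dest: G1.arc_neq)
  next
    case False
    then have "eccentricity H (Inl (Inl u)) = 4" "eccentricity H (Inl (Inl v)) = 4"
      using eccentricity_vertex_nonadjacent[OF u v] eccentricity_vertex_nonadjacent[OF v u] G1.arc_sym by auto
    then show ?thesis using False u v
      by (simp add: eccentricity_entry_def gdist_join join_vertex_iff adjacency_entry_def)
  qed
  show ?thesis
  proof (cases "join_block x = 0 \<and> join_block y = 0")
    case True
    then show ?thesis using x y
      by (elim join_vertex_cases) (simp_all add: vv block_weight_def)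
  next
    case False
    then show ?thesis using x y
      by (elim join_vertex_cases)
        (auto simp: eccentricity_entry_def gdist_join join_vertex_iff eccentricity_edge eccentricity_right
          block_weight_def adjacency_entry_def min_def dest: eccentricity_vertex_ge G2.arc_neq)
  qed
qed

lemma join_block_fibres:
  "{x \<in> pverts H. join_block x = 0} = (Inl \<circ> Inl) ` pverts G1"
  "{x \<in> pverts H. join_block x = 1} = (Inl \<circ> Inr) ` edges G1"
  "{x \<in> pverts H. join_block x = 2} = Inr ` pverts G2"
  by (auto simp: pverts_join)

lemma join_blocks_nth: "l < 3 \<Longrightarrow> join_blocks G1 G2 ! l = {x \<in> pverts H. join_block x = l}"
proof -
  assume "l < 3"
  then consider "l = 0" | "l = 1" | "l = 2" by linarith
  then show ?thesis by cases (simp_all only: join_block_fibres, simp_all add: join_blocks_def)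
qed

lemma join_block_less: "join_block x < 3"
  by (cases x rule: join_block.cases) auto

text \<open>Regularity, and the two ends of each edge, make the sums depend on \<open>x\<close> only
  through its block. This is the invariance of the span of the block indicators.\<close>

lemma sum_join_core:
  assumes x: "x \<in> pverts H" and l: "l < 3"
  shows "(\<Sum>y | y \<in> pverts H \<and> join_block y = l. join_core G1 G2 x y) = join_core_quotient r1 r2 (join_block x) l"
proof -
  have reindex: "(\<Sum>y\<in>(Inl \<circ> Inl) ` pverts G1. f y) = (\<Sum>u\<in>pverts G1. f (Inl (Inl u)))"
    "(\<Sum>y\<in>(Inl \<circ> Inr) ` edges G1. f y) = (\<Sum>e\<in>edges G1. f (Inl (Inr e)))"
    "(\<Sum>y\<in>Inr ` pverts G2. f y) = (\<Sum>w\<in>pverts G2. f (Inr w))"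
    for f :: "('a + 'a set) + 'b \<Rightarrow> real"
    by (subst sum.reindex; simp add: inj_on_def)+
  have e: "card (pverts G1 \<inter> e) = 2" if "e \<in> edges G1" for e
    using G1.edge_card[OF that] G1.edge_subset[OF that] by (simp add: Int_absorb1)
  have v: "(\<Sum>e\<in>edges G1. of_bool (u \<in> e)) = real r1" if "u \<in> pverts G1" for u
    using G1.card_incident_edges[OF regular1 that] G1.finite_edges by (simp add: Int_def)
  have d1: "(\<Sum>v\<in>pverts G1. of_bool (u = v) :: real) = 1" if "u \<in> pverts G1" for u
    using that G1.pair_finite_verts by simp
  have d2: "(\<Sum>v\<in>pverts G2. of_bool (u = v) :: real) = 1" if "u \<in> pverts G2" for u
    using that G2.pair_finite_verts by simp
  consider "l = 0" | "l = 1" | "l = 2" using l by linarith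
  then show ?thesis using x
    by (cases; elim join_vertex_cases; simp only: join_block_fibres reindex join_core.simps join_block.simps)
      (simp_all add: join_core_quotient_def e v d1 d2 sum_negf sum_subtractf sum.distrib
        G1.sum_adjacency_entry[OF regular1] G2.sum_adjacency_entry[OF regular2] flip: sum_distrib_left)
qed

end

section \<open>The spectrum\<close>

definition join_factor :: "nat \<Rightarrow> real \<Rightarrow> real poly" where
  "join_factor r l = [:- 9 * (l + real r), 4 * (1 + l), 1:]"

lemma poly_join_factor: "poly (join_factor r l) x = x\<^sup>2 + 4 * (1 + l) * x - 9 * (l + real r)"
  by (simp add: join_factor_def algebra_simps power2_eq_square)

text \<open>The hypothesis makes the radicand nonnegative; HOL's \<open>sqrt\<close> is also real on
  negative numbers, where squaring would not give the radicand back.\<close>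

lemma join_factor_split:
  assumes "- real r \<le> l"
  defines "s \<equiv> sqrt (4 * (1 + l)\<^sup>2 + 9 * (l + real r))"
  shows "join_factor r l = [:- (- 2 * (1 + l) + s), 1:] * [:- (- 2 * (1 + l) - s), 1:]"
proof -
  have "s\<^sup>2 = 4 * (1 + l)\<^sup>2 + 9 * (l + real r)" unfolding s_def using assms(1) by simp
  then show ?thesis by (simp add: join_factor_def algebra_simps power2_eq_square)
qed

text \<open>The indicators of \<open>V(G1)\<close> and \<open>I(G1)\<close> carry the factor of the
  eigenvalue \<open>r1\<close>, that of \<open>V(G2)\<close> the factor of \<open>r2\<close>. Both
  are cancelled in the end.\<close>

lemma char_poly_join_core_quotient:
  "char_poly (matrix_on [0..<3] (join_core_quotient r1 r2)) = join_factor r1 (real r1) * [:2 * (1 + real r2), 1:]"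
proof -
  have l: "[0..<3] = [0, 1] @ [2 :: nat]" by (simp add: numeral_3_eq_3 numeral_2_eq_2)
  have z: "rect_mat [0, 1] [2] (join_core_quotient r1 r2) = 0\<^sub>m 2 1"
    "rect_mat [2] [0, 1] (join_core_quotient r1 r2) = 0\<^sub>m 1 2"
    by (subst rect_mat_zero; auto simp: join_core_quotient_def)+
  have "matrix_on [0..<3] (join_core_quotient r1 r2) =
      four_block_mat (matrix_on [0, 1] (join_core_quotient r1 r2)) (0\<^sub>m 2 1) (0\<^sub>m 1 2) (matrix_on [2] (join_core_quotient r1 r2))"
    unfolding l matrix_on_eq_rect_mat rect_mat_append z ..
  then have "char_poly (matrix_on [0..<3] (join_core_quotient r1 r2)) =
      char_poly (matrix_on [0, 1] (join_core_quotient r1 r2)) * char_poly (matrix_on [2] (join_core_quotient r1 r2))"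
    by (simp only:) (rule char_poly_four_block_upper_right_zero, simp_all add: matrix_on_def numeral_2_eq_2)
  moreover have "char_poly (matrix_on [0, 1] (join_core_quotient r1 r2)) = join_factor r1 (real r1)"
  proof (rule poly_eqI_away_from_0[of 1])
    fix x
    show "x ^ 1 * poly (char_poly (matrix_on [0, 1] (join_core_quotient r1 r2))) x = x ^ 1 * poly (join_factor r1 (real r1)) x"
      using poly_char_poly_two_by_two[of "join_core_quotient r1 r2" x]
      by (simp add: poly_join_factor join_core_quotient_def algebra_simps)
  qed
  moreover have "char_poly (matrix_on [2] (join_core_quotient r1 r2)) = [:2 * (1 + real r2), 1:]"
    by (simp add: char_poly_def char_poly_matrix_def matrix_on_def det_single join_core_quotient_def)
  ultimately show ?thesis by simp
qed

context regular_join
begin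

text \<open>With \<open>P = - 4 (I + A1)\<close> and \<open>B C = 9 (A1 + r1 I)\<close> the Schur
  complement is affine in \<open>A1\<close>, so its determinant is a product over the eigenvalues of
  \<open>A1\<close>.\<close>

lemma char_poly_join_core_left:
  assumes vs1: "distinct vs1" "set vs1 = pverts G1" and es: "distinct es" "set es = edges G1"
    and S1: "char_poly (adjacency_matrix vs1 G1) = (\<Prod>l\<in>#S1. [:- l, 1:])"
    and le: "card (pverts G1) \<le> card (edges G1)"
  shows "char_poly (matrix_on (map (Inl \<circ> Inl) vs1 @ map (Inl \<circ> Inr) es) (join_core G1 G2)) =
    monom 1 (card (edges G1) - card (pverts G1)) * (\<Prod>l\<in>#S1. join_factor r1 l)" (is "char_poly ?M = _")
proof (rule poly_eqI_away_from_0[of "length vs1"])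
  fix x :: real
  have len: "length vs1 = card (pverts G1)" "length es = card (edges G1)"
    using vs1 es distinct_card by metis+
  define P where "P = rect_mat vs1 vs1 (\<lambda>u v. - 4 * (of_bool (u = v) + adjacency_entry G1 u v))"
  define B where "B = rect_mat vs1 es (\<lambda>u e. - 3 * of_bool (u \<in> e))"
  define C where "C = rect_mat es vs1 (\<lambda>e u. - 3 * of_bool (u \<in> e))"
  have M: "?M = four_block_mat P B C (0\<^sub>m (length es) (length es))"
    unfolding matrix_on_eq_rect_mat rect_mat_append P_def B_def C_def
    by (simp add: rect_mat_map rect_mat_zero)
  have BC: "B * C = rect_mat vs1 vs1 (\<lambda>u v. 9 * (adjacency_entry G1 u v + real r1 * of_bool (u = v)))"
    unfolding B_def C_def rect_mat_mult[OF es(1)]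
  proof (intro rect_mat_cong)
    fix u v assume u: "u \<in> set vs1"
    have "(\<Sum>e\<in>set es. - 3 * of_bool (u \<in> e) * (- 3 * of_bool (v \<in> e))) =
        9 * (\<Sum>e\<in>edges G1. of_bool (u \<in> e) * of_bool (v \<in> e) :: real)"
      unfolding es(2) sum_distrib_left by (rule sum.cong) simp_all
    then show "(\<Sum>e\<in>set es. - 3 * of_bool (u \<in> e) * (- 3 * of_bool (v \<in> e))) =
        9 * (adjacency_entry G1 u v + real r1 * of_bool (u = v))"
      using G1.sum_incidence_products[OF regular1, of u v] u vs1 by simp
  qed
  have "x\<^sup>2 \<cdot>\<^sub>m 1\<^sub>m (length vs1) - x \<cdot>\<^sub>m P - B * C =
      (x\<^sup>2 + 4 * x - 9 * real r1) \<cdot>\<^sub>m 1\<^sub>m (length vs1) + (4 * x - 9) \<cdot>\<^sub>m adjacency_matrix vs1 G1"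
    unfolding BC P_def rect_mat_one[OF vs1(1)] adjacency_matrix_def matrix_on_eq_rect_mat
      rect_mat_smult rect_mat_diff rect_mat_add
    by (intro rect_mat_cong) (simp add: algebra_simps)
  moreover have "det ((x\<^sup>2 + 4 * x - 9 * real r1) \<cdot>\<^sub>m 1\<^sub>m (length vs1) + (4 * x - 9) \<cdot>\<^sub>m adjacency_matrix vs1 G1) =
      (\<Prod>l\<in>#S1. x\<^sup>2 + 4 * x - 9 * real r1 + (4 * x - 9) * l)"
    by (rule det_linear_combination[OF _ S1]) (simp add: adjacency_matrix_def)
  moreover have "\<dots> = poly (\<Prod>l\<in>#S1. join_factor r1 l) x"
    by (induction S1) (simp_all add: poly_join_factor algebra_simps)
  moreover have "x ^ length vs1 * poly (char_poly ?M) x =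
      x ^ length es * det (x\<^sup>2 \<cdot>\<^sub>m 1\<^sub>m (length vs1) - x \<cdot>\<^sub>m P - B * C)"
    unfolding M by (rule poly_char_poly_four_block_lower_right_zero) (simp_all add: P_def B_def C_def)
  \<comment> \<open>By \<open>le\<close> the truncated difference in the exponent is the true
    one.\<close>
  moreover have "x ^ length es = x ^ length vs1 * x ^ (card (edges G1) - card (pverts G1))"
    using le by (simp add: len flip: power_add)
  ultimately show "x ^ length vs1 * poly (char_poly ?M) x = x ^ length vs1 *
      poly (monom 1 (card (edges G1) - card (pverts G1)) * (\<Prod>l\<in>#S1. join_factor r1 l)) x"
    by (simp only: poly_mult poly_monom mult_1 mult.assoc)
qed

lemma char_poly_join_core_right:
  assumes vs2: "distinct vs2"
    and S2: "char_poly (adjacency_matrix vs2 G2) = (\<Prod>l\<in>#S2. [:- l, 1:])"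
  shows "char_poly (matrix_on (map Inr vs2) (join_core G1 G2)) = (\<Prod>l\<in>#S2. [:2 * (1 + l), 1:])"
proof (rule poly_eqI_away_from_0[of 0])
  fix x :: real
  let ?M = "matrix_on (map Inr vs2) (join_core G1 G2)"
  have "poly (char_poly ?M) x = det (x \<cdot>\<^sub>m 1\<^sub>m (length vs2) - ?M)"
    by (rule poly_char_poly) (simp add: matrix_on_def)
  also have "x \<cdot>\<^sub>m 1\<^sub>m (length vs2) - ?M = (x + 2) \<cdot>\<^sub>m 1\<^sub>m (length vs2) + 2 \<cdot>\<^sub>m adjacency_matrix vs2 G2"
    unfolding rect_mat_one[OF vs2(1)] adjacency_matrix_def matrix_on_eq_rect_mat rect_mat_map
      rect_mat_smult rect_mat_diff rect_mat_add
    by (intro rect_mat_cong) (simp add: algebra_simps)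
  also have "det \<dots> = (\<Prod>l\<in>#S2. x + 2 + 2 * l)"
    by (rule det_linear_combination[OF _ S2]) (simp add: adjacency_matrix_def)
  also have "\<dots> = poly (\<Prod>l\<in>#S2. [:2 * (1 + l), 1:]) x"
    by (induction S2) (simp_all add: algebra_simps)
  finally show "x ^ 0 * poly (char_poly ?M) x = x ^ 0 * poly (\<Prod>l\<in>#S2. [:2 * (1 + l), 1:]) x" by simp
qed

text \<open>From the handshake identity: \<open>2 p1 \<le> r1 p1 = 2 q1\<close>.\<close>

lemma card_vertices_le_edges: "card (pverts G1) \<le> card (edges G1)"
proof -
  have "2 * card (pverts G1) \<le> 2 * card (edges G1)"
    using G1.handshake[OF regular1] mult_le_mono1[OF r1, of "card (pverts G1)"] by simp
  then show ?thesis by simp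
qed

text \<open>Both the equitability of the partition and the entries of its quotient matrix are read
  off from this.\<close>

lemma sum_eccentricity_entry_block:
  assumes x: "x \<in> pverts H" and l: "l < 3"
  shows "(\<Sum>y\<in>join_blocks G1 G2 ! l. eccentricity_entry H x y) =
    join_core_quotient r1 r2 (join_block x) l + block_weight (join_block x) l * real (card (join_blocks G1 G2 ! l))"
proof -
  have "(\<Sum>y\<in>join_blocks G1 G2 ! l. eccentricity_entry H x y) =
      (\<Sum>y | y \<in> pverts H \<and> join_block y = l. join_core G1 G2 x y + block_weight (join_block x) l)"
    unfolding join_blocks_nth[OF l] using x by (intro sum.cong) (auto simp: eccentricity_entry_join)
  then show ?thesis by (simp add: sum.distrib sum_join_core[OF x l] join_blocks_nth[OF l])
qed

lemma join_blocks_card: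
  "card (join_blocks G1 G2 ! 0) = card (pverts G1)"
  "card (join_blocks G1 G2 ! 1) = card (edges G1)"
  "card (join_blocks G1 G2 ! 2) = card (pverts G2)"
  by (simp_all add: join_blocks_def card_image inj_on_def)

lemma join_blocks_length: "length (join_blocks G1 G2) = 3"
  by (simp add: join_blocks_def)

lemma join_blocks_memD: "i < 3 \<Longrightarrow> x \<in> join_blocks G1 G2 ! i \<Longrightarrow> x \<in> pverts H \<and> join_block x = i"
  by (simp add: join_blocks_nth)

text \<open>The matrix \<open>E + V U\<close> of the block-constant update, which is also the
  quotient matrix of the eccentricity matrix.\<close>

definition join_quotient :: "nat \<Rightarrow> nat \<Rightarrow> real" where
  "join_quotient i j = join_core_quotient r1 r2 i j + block_weight i j * real (card (join_blocks G1 G2 ! j))"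

lemma join_blocks_nonempty: "i < 3 \<Longrightarrow> join_blocks G1 G2 ! i \<noteq> {}"
proof -
  assume "i < 3"
  moreover have "edges G1 \<noteq> {}"
    using nonempty1 G1.incident_edgeE[OF regular1 r1] by blast
  ultimately show ?thesis using nonempty1 nonempty2
    by (auto simp: join_blocks_def less_Suc_eq numeral_3_eq_3 numeral_2_eq_2)
qed

lemma join_blocks_finite: "i < 3 \<Longrightarrow> finite (join_blocks G1 G2 ! i)"
  by (simp add: join_blocks_nth finite_pverts_join)

lemma equitable_join: "equitable_partition (eccentricity_entry H) (pverts H) (join_blocks G1 G2)"
proof -
  have blocks: "\<exists>i<3. X = join_blocks G1 G2 ! i" if "X \<in> set (join_blocks G1 G2)" for X
    using that by (auto simp: in_set_conv_nth join_blocks_length)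
  have "distinct (join_blocks G1 G2)"
    unfolding distinct_conv_nth join_blocks_length
    using join_blocks_memD join_blocks_nonempty by (metis all_not_in_conv)
  moreover have "partition_on (pverts H) (set (join_blocks G1 G2))"
  proof (rule partition_onI)
    show "\<Union> (set (join_blocks G1 G2)) = pverts H"
      by (auto simp: join_blocks_def pverts_join)
    show "disjnt X Y" if "X \<in> set (join_blocks G1 G2)" "Y \<in> set (join_blocks G1 G2)" "X \<noteq> Y" for X Y
      using blocks[OF that(1)] blocks[OF that(2)] that(3) join_blocks_memD unfolding disjnt_iff by metis
    show "{} \<notin> set (join_blocks G1 G2)" 
      using blocks join_blocks_nonempty by metis
  qed
  moreover have "(\<Sum>v\<in>Y. eccentricity_entry H u v) = (\<Sum>v\<in>Y. eccentricity_entry H u' v)"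
    if XY: "X \<in> set (join_blocks G1 G2)" "Y \<in> set (join_blocks G1 G2)" and u: "u \<in> X" "u' \<in> X" for X Y u u'
  proof -
    obtain i j where ij: "i < 3" "X = join_blocks G1 G2 ! i" "j < 3" "Y = join_blocks G1 G2 ! j"
      using blocks[OF XY(1)] blocks[OF XY(2)] by blast
    then show ?thesis
      using join_blocks_memD[of i u] join_blocks_memD[of i u'] u by (simp add: sum_eccentricity_entry_block)
  qed
  ultimately show ?thesis unfolding equitable_partition_def by blast
qed

lemma quotient_matrix_join:
  "quotient_matrix (eccentricity_entry H) (join_blocks G1 G2) = matrix_on [0..<3] join_quotient"
proof (rule eq_matI)
  fix i j assume "i < dim_row (matrix_on [0..<3] join_quotient)" "j < dim_col (matrix_on [0..<3] join_quotient)"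
  then have ij: "i < 3" "j < 3" by (simp_all add: matrix_on_def)
  have "(\<Sum>u\<in>join_blocks G1 G2 ! i. \<Sum>v\<in>join_blocks G1 G2 ! j. eccentricity_entry H u v) =
      (\<Sum>u\<in>join_blocks G1 G2 ! i. join_quotient i j)"
    using join_blocks_memD[OF ij(1)] ij(2)
    by (intro sum.cong) (auto simp: sum_eccentricity_entry_block join_quotient_def)
  \<comment> \<open>Excludes the default value of division by 0 in the average.\<close>
  moreover have "card (join_blocks G1 G2 ! i) \<noteq> 0"
    using join_blocks_finite[OF ij(1)] join_blocks_nonempty[OF ij(1)] by simp
  ultimately show "quotient_matrix (eccentricity_entry H) (join_blocks G1 G2) $$ (i, j) =
      matrix_on [0..<3] join_quotient $$ (i, j)"
    using ij by (simp add: quotient_matrix_def matrix_on_def join_blocks_length)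
qed (simp_all add: quotient_matrix_def matrix_on_def join_blocks_length)

lemma join_quotient_matrix:
  "matrix_on [0..<3] join_quotient = mat_of_rows_list 3
    [[4 * (real (card (pverts G1)) - 1 - real r1), 3 * (real (card (edges G1)) - real r1), 2 * real (card (pverts G2))],
     [3 * (real (card (pverts G1)) - 2), 0, 0],
     [2 * real (card (pverts G1)), 0, 2 * (real (card (pverts G2)) - real r2 - 1)]]" (is "_ = ?Q")
proof (rule eq_matI)
  fix i j assume "i < dim_row ?Q" "j < dim_col ?Q"
  then have "i = 0 \<or> i = 1 \<or> i = 2" "j = 0 \<or> j = 1 \<or> j = 2"
    by (auto simp: mat_of_rows_list_def)
  moreover have "matrix_on [0..<3] join_quotient $$ (i, j) = join_quotient i j"
    using \<open>i < dim_row ?Q\<close> \<open>j < dim_col ?Q\<close> by (simp add: matrix_on_def mat_of_rows_list_def)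
  ultimately show "matrix_on [0..<3] join_quotient $$ (i, j) = ?Q $$ (i, j)"
    using join_blocks_card
    by (elim disjE; simp add: mat_of_rows_list_def join_quotient_def join_core_quotient_def block_weight_def)
qed (simp_all add: matrix_on_def mat_of_rows_list_def)

lemma char_poly_eccentricity_join:
  assumes vs1: "distinct vs1" "set vs1 = pverts G1" and vs2: "distinct vs2" "set vs2 = pverts G2"
    and vs: "distinct vs" "set vs = pverts H"
    and S1: "char_poly (adjacency_matrix vs1 G1) = (\<Prod>l\<in>#add_mset (real r1) S1. [:- l, 1:])"
    and S2: "char_poly (adjacency_matrix vs2 G2) = (\<Prod>l\<in>#add_mset (real r2) S2. [:- l, 1:])"
  shows "char_poly (eccentricity_matrix vs H) =
    monom 1 (card (edges G1) - card (pverts G1)) * (\<Prod>l\<in>#S1. join_factor r1 l) *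
    (\<Prod>l\<in>#S2. [:2 * (1 + l), 1:]) * char_poly (matrix_on [0..<3] join_quotient)"
proof -
  let ?m = "monom 1 (card (edges G1) - card (pverts G1)) :: real poly"
  obtain es where es: "distinct es" "set es = edges G1"
    using finite_distinct_list[OF G1.finite_edges] by blast
  define vsL :: "(('a + 'a set) + 'b) list" where "vsL = map (Inl \<circ> Inl) vs1 @ map (Inl \<circ> Inr) es"
  define vsR :: "(('a + 'a set) + 'b) list" where "vsR = map Inr vs2"
  have ws: "distinct (vsL @ vsR)" "set (vsL @ vsR) = pverts H"
    using vs1 vs2 es by (auto simp: vsL_def vsR_def distinct_map inj_on_def pverts_join)
  \<comment> \<open>Entries between \<open>V(G2)\<close> and the rest are block-constant, so the
    core has none and splits.\<close>
  have "matrix_on (vsL @ vsR) (join_core G1 G2) = four_block_mat (matrix_on vsL (join_core G1 G2))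
      (0\<^sub>m (length vsL) (length vsR)) (0\<^sub>m (length vsR) (length vsL)) (matrix_on vsR (join_core G1 G2))"
    unfolding matrix_on_eq_rect_mat rect_mat_append
    by (intro cong_four_block_mat rect_mat_zero refl) (auto simp: vsL_def vsR_def)
  then have "char_poly (matrix_on (vsL @ vsR) (join_core G1 G2)) =
      char_poly (matrix_on vsL (join_core G1 G2)) * char_poly (matrix_on vsR (join_core G1 G2))"
    by (simp add: char_poly_four_block_upper_right_zero)
  also have "\<dots> = (?m * (\<Prod>l\<in>#add_mset (real r1) S1. join_factor r1 l)) * (\<Prod>l\<in>#add_mset (real r2) S2. [:2 * (1 + l), 1:])"
    unfolding vsL_def vsR_def
      char_poly_join_core_left[OF vs1 es S1 card_vertices_le_edges] char_poly_join_core_right[OF vs2(1) S2] ..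
  finally have join_core: "char_poly (matrix_on (vsL @ vsR) (join_core G1 G2)) = \<dots>" .
  have "eccentricity_matrix vs H = matrix_on vs (\<lambda>x y. join_core G1 G2 x y + block_weight (join_block x) (join_block y))"
    unfolding eccentricity_matrix_def matrix_on_eq_rect_mat
    using vs by (intro rect_mat_cong) (simp add: eccentricity_entry_join)
  then have "char_poly (eccentricity_matrix vs H) =
      char_poly (matrix_on (vsL @ vsR) (\<lambda>x y. join_core G1 G2 x y + block_weight (join_block x) (join_block y)))"
    using char_poly_matrix_on_cong_set[OF vs(1) ws(1)] vs(2) ws(2) by simp
  moreover have "char_poly (matrix_on (vsL @ vsR) (\<lambda>x y. join_core G1 G2 x y + block_weight (join_block x) (join_block y))) *
      char_poly (matrix_on [0..<3] (join_core_quotient r1 r2)) =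
      char_poly (matrix_on (vsL @ vsR) (join_core G1 G2)) *
      char_poly (matrix_on [0..<3] (\<lambda>i j. join_core_quotient r1 r2 i j +
        block_weight i j * real (card {y \<in> set (vsL @ vsR). join_block y = j})))"
    using ws by (intro char_poly_add_block_constant) (auto simp: join_block_less sum_join_core)
  moreover have "matrix_on [0..<3] (\<lambda>i j. join_core_quotient r1 r2 i j +
        block_weight i j * real (card {y \<in> set (vsL @ vsR). join_block y = j})) = matrix_on [0..<3] join_quotient"
    unfolding ws(2) matrix_on_eq_rect_mat
    by (intro rect_mat_cong) (simp add: join_quotient_def join_blocks_nth)
  ultimately have "char_poly (eccentricity_matrix vs H) * (join_factor r1 (real r1) * [:2 * (1 + real r2), 1:]) =
      (?m * (\<Prod>l\<in>#S1. join_factor r1 l) * (\<Prod>l\<in>#S2. [:2 * (1 + l), 1:]) *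
      char_poly (matrix_on [0..<3] join_quotient)) * (join_factor r1 (real r1) * [:2 * (1 + real r2), 1:])"
    by (simp only: join_core char_poly_join_core_quotient image_mset_add_mset prod_mset.add_mset mult_ac)
  \<comment> \<open>Cancelling this product removes the contributions of \<open>r1\<close> and
    \<open>r2\<close>.\<close>
  moreover have "join_factor r1 (real r1) * [:2 * (1 + real r2), 1:] \<noteq> 0"
    by (simp add: join_factor_def del: mult_pCons_left mult_pCons_right)
  ultimately show ?thesis using mult_right_cancel by blast
qed

end

theorem theorem4p2:
  fixes G1 :: "'a pair_pre_digraph" and G2 :: "'b pair_pre_digraph"
    and r1 r2 p1 p2 q1 q2 :: nat
    and lam gam :: "nat \<Rightarrow> real"
    and vs1 :: "'a list" and vs2 :: "'b list" and vs :: "(('a + 'a set) + 'b) list"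
    and Q :: "real mat"
  assumes G1: "pair_graph G1" "Digraph_Component.connected (with_proj G1)" "regular G1 r1"
    and G2: "pair_graph G2" "Digraph_Component.connected (with_proj G2)" "regular G2 r2"
    and card1: "card (pverts G1) = p1" "card (edges G1) = q1"
    and card2: "card (pverts G2) = p2" "card (edges G2) = q2"
    and r1: "r1 \<ge> 2"
    and vs1: "distinct vs1" "set vs1 = pverts G1"
    and vs2: "distinct vs2" "set vs2 = pverts G2"
    and vs: "distinct vs" "set vs = pverts (subdivision_edge_join G1 G2)"
    and eig1: "eigenvalues (adjacency_matrix vs1 G1) =
      image_mset complex_of_real ({#real r1#} + image_mset lam (mset_set {2..p1}))"
    and eig2: "eigenvalues (adjacency_matrix vs2 G2) =
      image_mset complex_of_real ({#real r2#} + image_mset gam (mset_set {2..p2}))"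
    and Q: "Q = mat_of_rows_list 3
      [[4 * (real p1 - 1 - real r1), 3 * (real q1 - real r1), 2 * real p2],
       [3 * (real p1 - 2), 0, 0],
       [2 * real p1, 0, 2 * (real p2 - real r2 - 1)]]"
  shows
    "eigenvalues (eccentricity_matrix vs (subdivision_edge_join G1 G2)) =
      image_mset complex_of_real
       (replicate_mset (q1 - p1) 0
        + image_mset (\<lambda>k. - 2 * (1 + gam k)) (mset_set {2..p2})
        + image_mset (\<lambda>i. - 2 * (1 + lam i) + sqrt (4 * (1 + lam i)^2 + 9 * (lam i + real r1)))
            (mset_set {2..p1})
        + image_mset (\<lambda>i. - 2 * (1 + lam i) - sqrt (4 * (1 + lam i)^2 + 9 * (lam i + real r1)))
            (mset_set {2..p1}))
      + eigenvalues Q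
     \<and> p1 \<le> q1
     \<and> equitable_partition (eccentricity_entry (subdivision_edge_join G1 G2))
        (pverts (subdivision_edge_join G1 G2)) (join_blocks G1 G2)
     \<and> quotient_matrix (eccentricity_entry (subdivision_edge_join G1 G2)) (join_blocks G1 G2) = Q"
proof -
  \<comment> \<open>The library's connectedness includes having a vertex.\<close>
  have ne: "pverts G1 \<noteq> {}" "pverts G2 \<noteq> {}"
    using G1(2) G2(2) by (auto simp: connected_def strongly_connected_def)
  interpret regular_join G1 G2 r1 r2
    using G1 G2 r1 ne by (simp add: regular_join_def regular_join_axioms_def)
  define S1 where "S1 = image_mset lam (mset_set {2..p1})"
  define S2 where "S2 = image_mset gam (mset_set {2..p2})"
  define d where "d = (\<lambda>l. sqrt (4 * (1 + l)^2 + 9 * (l + real r1)))"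
  have cp1: "char_poly (adjacency_matrix vs1 G1) = (\<Prod>l\<in>#add_mset (real r1) S1. [:- l, 1:])"
    using eig1 by (intro char_poly_real_eigenvalues[of _ "length vs1"]) (simp_all add: adjacency_matrix_def S1_def)
  have cp2: "char_poly (adjacency_matrix vs2 G2) = (\<Prod>l\<in>#add_mset (real r2) S2. [:- l, 1:])"
    using eig2 by (intro char_poly_real_eigenvalues[of _ "length vs2"]) (simp_all add: adjacency_matrix_def S2_def)
  \<comment> \<open>Each listed eigenvalue is a root of the characteristic polynomial, hence has an
    eigenvector to which the maximal-coordinate bound applies.\<close>
  have ge: "- real r1 \<le> l" if "l \<in># S1" for l
  proof (rule G1.adjacency_eigenvalue_ge[OF regular1 vs1])
    have "poly (char_poly (adjacency_matrix vs1 G1)) l = 0"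
      using that by (simp add: cp1 poly_prod_mset prod_mset_zero_iff image_iff)
    then show "eigenvalue (adjacency_matrix vs1 G1) l"
      using eigenvalue_root_char_poly[of "adjacency_matrix vs1 G1" "length vs1"] by (simp add: adjacency_matrix_def)
  qed
  have Q': "Q = matrix_on [0..<3] join_quotient"
    unfolding Q join_quotient_matrix card1 card2 ..
  define S where "S = replicate_mset (q1 - p1) 0 + image_mset (\<lambda>l. - 2 * (1 + l)) S2
    + image_mset (\<lambda>l. - 2 * (1 + l) + d l) S1 + image_mset (\<lambda>l. - 2 * (1 + l) - d l) S1"
  have zero: "(\<Prod>l\<in>#replicate_mset n 0. [:- l, 1:]) = (monom 1 n :: real poly)" for n
    by (induction n) (simp_all add: monom_Suc)
  have left: "(\<Prod>l\<in>#S1. join_factor r1 l) =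
      (\<Prod>l\<in>#image_mset (\<lambda>l. - 2 * (1 + l) + d l) S1. [:- l, 1:]) *
      (\<Prod>l\<in>#image_mset (\<lambda>l. - 2 * (1 + l) - d l) S1. [:- l, 1:])"
  proof -
    have "(\<Prod>l\<in>#S1. join_factor r1 l) =
        (\<Prod>l\<in>#S1. [:- (- 2 * (1 + l) + d l), 1:] * [:- (- 2 * (1 + l) - d l), 1:])"
      using ge by (intro arg_cong[where f = prod_mset] image_mset_cong) (simp only: d_def join_factor_split)
    then show ?thesis by (simp only: prod_mset.distrib image_mset.compositionality o_def)
  qed
  have right: "(\<Prod>l\<in>#S2. [:2 * (1 + l), 1:]) = (\<Prod>l\<in>#image_mset (\<lambda>l. - 2 * (1 + l)) S2. [:- l, 1:])"
    by (simp add: image_mset.compositionality o_def algebra_simps)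
  have "char_poly (eccentricity_matrix vs H) = (\<Prod>l\<in>#S. [:- l, 1:]) * char_poly Q"
    unfolding char_poly_eccentricity_join[OF vs1 vs2 vs cp1 cp2] card1 Q' S_def image_mset_union
      prod_mset.union left right zero by (simp only: mult_ac)
  then have "eigenvalues (eccentricity_matrix vs H) = image_mset complex_of_real S + eigenvalues Q"
    by (intro eigenvalues_char_poly_mult[of _ "length vs" _ 3]) (simp_all add: eccentricity_matrix_def Q' matrix_on_def)
  moreover have "p1 \<le> q1" using card_vertices_le_edges card1 by simp
  moreover have "quotient_matrix (eccentricity_entry H) (join_blocks G1 G2) = Q"
    unfolding Q' by (rule quotient_matrix_join)
  ultimately show ?thesis
    using equitable_join by (simp only: S_def S1_def S2_def d_def image_mset.compositionality o_def simp_thms)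
qed

end
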